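(* Let $\mathbb{K}$ be a field of characteristic $0$ and $\lambda\in\mathbb{K}$ nonzero. Let $A$ be an associative $\mathbb{K}$-algebra, $B$ an associative $A$-bimodule and $P:B\to A$ a relative averaging operator of weight $\lambda$. Define $d_P:C^n(B,A)\to C^{n+1}(B,A)$, $n\ge1$, by $d_P(f)=df+\llbracket P,f\rrbracket$. Then $d_P$ is a differential, that is, $(d_P)^2=0$.
   Context: An associative $A$-bimodule is an associative algebra $B$ (product $xy$) with linear maps $A\otimes B\to B$, $(a,x)\mapsto a\cdot x$ and $B\otimes A\to B$, $(x,a)\mapsto x\cdot a$ such that for all $a,b\in A$, $x,y\in B$: $(ab)\cdot x=a\cdot(b\cdot x)$, $(a\cdot x)\cdot b=a\cdot(x\cdot b)$, $(x\cdot a)\cdot b=x\cdot(ab)$, $(xy)\cdot a=x(y\cdot a)$, $(x\cdot a)y=x(a\cdot y)$, $(a\cdot x)y=a\cdot(xy)$. A linear map $P:B\to A$ is a relative averaging operator of weight $\lambda$ if $P(x)P(y)=P(P(x)\cdot y)=P(x\cdot P(y))=\lambda P(xy)$ for all $x,y\in B$. Trees. For $n\ge1$, $T_n$ is the set of planar rooted trees with $n+1$ leaves in which every internal vertex has at least two incoming edges; $T_0=\{|\}$. Leaves are labelled $0,\dots,n$ from left to right. $d_i:T_n\to T_{n-1}$ deletes the $i$-th leaf (a vertex left with a single incoming edge is suppressed). For $m,n\ge1$, $1\le i\le m$ and $T\in T_{m+n-1}$: $R_0^{m;i,n}(T)\in T_m$ is obtained from $T$ by deleting the leaves $i,\dots,i+n-2$,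 and $R_i^{m;i,n}(T)\in T_n$ by deleting all leaves except $i-1,i,\dots,i+n-1$. $T_1$ has one element, so $\mathrm{Hom}(B,A)=C^1(B,A)$. $T_2=\{T^{\dashv},T^{\vdash},T^{\perp}\}$, where in $T^{\dashv}$ leaves 1,2 are joined at a vertex above the root vertex, in $T^{\vdash}$ leaves 0,1 are joined at a vertex above the root vertex, and $T^{\perp}$ has one vertex with three leaves. For a vector space $D$, $C^n(D,D)=\mathrm{Hom}(\mathbb{K}[T_n]\otimes D^{\otimes n},D)$. For $f\in C^m(D,D)$, $g\in C^n(D,D)$, $1\le i\le m$, $$(f\circ_ig)(T;x_1,\dots,x_{m+n-1})=f\big(R_0^{m;i,n}(T);x_1,\dots,x_{i-1},g(R_i^{m;i,n}(T);x_i,\dots,x_{i+n-1}),x_{i+n},\dots,x_{m+n-1}\big),$$ $$[f,g]=\sum_{i=1}^m(-1)^{(i-1)(n-1)}f\circ_ig-(-1)^{(m-1)(n-1)}\sum_{i=1}^n(-1)^{(i-1)(m-1)}g\circ_if.$$ Take $D=A\oplus B$; $C^n(B,A)=\mathrm{Hom}(\mathbb{K}[T_n]\otimes B^{\otimes n},A)$ is viewed inside $C^n(A\oplus B,A\oplus B)$ by extending by zero. Define $\pi_\lambda\in C^2(A\oplus B,A\oplus B)$ by $\pi_\lambda(T^{\dashv};(a,x),(b,y))=(ab,x\cdot b)$, $\pi_\lambda(T^{\vdash};(a,x),(b,y))=(ab,a\cdot y)$, $\pi_\lambda(T^{\perp};(a,x),(b,y))=(ab,\lambda xy)$. The bracket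 is $\llbracket f,g\rrbracket=(-1)^m[[\pi_\lambda,f],g]$ for $f\in C^m(B,A)$, $g\in C^n(B,A)$, and $d:C^n(B,A)\to C^{n+1}(B,A)$ is $$(df)(T;x_1,\dots,x_{n+1})=(-1)^{n-1}\sum_{i=1}^n(-1)^{i-1}f\big(d_iT;x_1,\dots,x_{i-1},\pi_\lambda(R_i^{n;i,2}(T);x_i,x_{i+1}),x_{i+2},\dots,x_{n+1}\big),$$ where $\pi_\lambda(S;x,y)$ for $x,y\in B$ equals $\lambda xy$ if $S=T^{\perp}$ and $0$ otherwise. *)

theory Defs
  imports "HOL.Vector_Spaces" "HOL-Library.Product_Plus"
begin

text \<open>
  Class \<open>ring\<close> is not assumed to have a unit; the scalar multiplication is an explicit
  function, as in \<^locale>\<open>vector_space\<close>.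
\<close>

locale assoc_algebra = vector_space scale
  for scale :: "'k::field \<Rightarrow> 'a::ring \<Rightarrow> 'a" +
  assumes scale_mult_left: "scale c x * y = scale c (x * y)"
    and scale_mult_right: "x * scale c y = scale c (x * y)"

locale assoc_bimodule =
  A: assoc_algebra sA + B: assoc_algebra sB
  for sA :: "'k::field \<Rightarrow> 'a::ring \<Rightarrow> 'a"
    and sB :: "'k \<Rightarrow> 'b::ring \<Rightarrow> 'b" +
  fixes lact :: "'a \<Rightarrow> 'b \<Rightarrow> 'b"
    and ract :: "'b \<Rightarrow> 'a \<Rightarrow> 'b"
  assumes lact_linear_alg: "Vector_Spaces.linear sA sB (\<lambda>a. lact a x)"
    and lact_linear_mod: "Vector_Spaces.linear sB sB (\<lambda>x. lact a x)"
    and ract_linear_mod: "Vector_Spaces.linear sB sB (\<lambda>x. ract x a)"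
    and ract_linear_alg: "Vector_Spaces.linear sA sB (\<lambda>a. ract x a)"
    and lact_lact: "lact (a * b) x = lact a (lact b x)"
    and lact_ract: "ract (lact a x) b = lact a (ract x b)"
    and ract_ract: "ract (ract x a) b = ract x (a * b)"
    and mult_ract: "ract (x * y) a = x * ract y a"
    and ract_mult_lact: "ract x a * y = x * lact a y"
    and lact_mult: "lact a x * y = lact a (x * y)"

definition relative_averaging ::
  "('k::field \<Rightarrow> 'a::ring \<Rightarrow> 'a) \<Rightarrow> ('k \<Rightarrow> 'b::ring \<Rightarrow> 'b) \<Rightarrow> ('a \<Rightarrow> 'b \<Rightarrow> 'b) \<Rightarrow> ('b \<Rightarrow> 'a \<Rightarrow> 'b)
    \<Rightarrow> 'k \<Rightarrow> ('b \<Rightarrow> 'a) \<Rightarrow> bool" where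
  "relative_averaging sA sB lact ract lam P \<longleftrightarrow>
     Vector_Spaces.linear sB sA P \<and>
     (\<forall>x y. P x * P y = P (lact (P x) y) \<and>
            P (lact (P x) y) = P (ract x (P y)) \<and>
            P (ract x (P y)) = sA lam (P (x * y)))"


datatype ptree = Leaf | Node "ptree list"

fun leaf_count :: "ptree \<Rightarrow> nat" where
  "leaf_count Leaf = 1"
| "leaf_count (Node ts) = sum_list (map leaf_count ts)"

fun reduced :: "ptree \<Rightarrow> bool" where
  "reduced Leaf \<longleftrightarrow> True"
| "reduced (Node ts) \<longleftrightarrow> 2 \<le> length ts \<and> (\<forall>t \<in> set ts. reduced t)"

definition trees :: "nat \<Rightarrow> ptree set" where
  "trees n = {T. reduced T \<and> leaf_count T = n + 1}"

text \<open>
  \<open>prune S k T\<close> deletes from \<open>T\<close>, whose leaves are numbered \<open>k, k + 1, \<dots>\<close> from left to right,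
  the leaves with number in \<open>S\<close>. The result has at most one element, and is empty iff no leaf
  survives. A vertex left without an incoming edge disappears, one left with a single incoming
  edge is suppressed.
\<close>

fun prune :: "nat set \<Rightarrow> nat \<Rightarrow> ptree \<Rightarrow> ptree list"
  and prune_list :: "nat set \<Rightarrow> nat \<Rightarrow> ptree list \<Rightarrow> ptree list" where
  "prune S k Leaf = (if k \<in> S then [] else [Leaf])"
| "prune S k (Node ts) =
     (let us = prune_list S k ts in if length us \<le> 1 then us else [Node us])"
| "prune_list S k [] = []"
| "prune_list S k (t # ts) = prune S k t @ prune_list S (k + leaf_count t) ts"

definition delete_leaves :: "nat set \<Rightarrow> ptree \<Rightarrow> ptree" where
  "delete_leaves S T = hd (prune S 0 T)"

definition face :: "nat \<Rightarrow> ptree \<Rightarrow> ptree" where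
  "face i T = delete_leaves {i} T"

definition R_outer :: "nat \<Rightarrow> nat \<Rightarrow> nat \<Rightarrow> ptree \<Rightarrow> ptree" where
  "R_outer m i n T = delete_leaves {i..i + n - 2} T"

definition R_inner :: "nat \<Rightarrow> nat \<Rightarrow> nat \<Rightarrow> ptree \<Rightarrow> ptree" where
  "R_inner m i n T = delete_leaves ({0..m + n - 1} - {i - 1..i + n - 1}) T"

definition T_dashv :: ptree where
  "T_dashv = Node [Leaf, Node [Leaf, Leaf]]"

definition T_vdash :: ptree where
  "T_vdash = Node [Node [Leaf, Leaf], Leaf]"

definition T_perp :: ptree where
  "T_perp = Node [Leaf, Leaf, Leaf]"


text \<open>
  A linear map from the tensor product of the span of \<open>trees n\<close> with the \<open>n\<close>-th tensor power of
  the source is given by its values on a tree and a list of \<open>n\<close> vectors, multilinear in the list.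
  These functions are normalised to vanish on all other arguments, so that equality of cochains
  is equality of functions.
\<close>

type_synonym ('d, 'e) cochain = "ptree \<Rightarrow> 'd list \<Rightarrow> 'e"

definition cochains ::
  "('k::field \<Rightarrow> 'd::ab_group_add \<Rightarrow> 'd) \<Rightarrow> ('k \<Rightarrow> 'e::ab_group_add \<Rightarrow> 'e) \<Rightarrow> nat
    \<Rightarrow> ('d, 'e) cochain set" where
  "cochains sD sE n =
     {f. (\<forall>T xs i. T \<in> trees n \<longrightarrow> length xs = n \<longrightarrow> i < n \<longrightarrow>
            Vector_Spaces.linear sD sE (\<lambda>x. f T (xs[i := x]))) \<and>
         (\<forall>T xs. T \<notin> trees n \<or> length xs \<noteq> n \<longrightarrow> f T xs = 0)}"

text \<open>Multiplication by \<open>(-1)\<^sup>k\<close>.\<close>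

definition signed :: "nat \<Rightarrow> 'd::ab_group_add \<Rightarrow> 'd" where
  "signed k v = (if even k then v else - v)"

definition partial_comp ::
  "nat \<Rightarrow> nat \<Rightarrow> nat \<Rightarrow> ('d::ab_group_add, 'd) cochain \<Rightarrow> ('d, 'd) cochain \<Rightarrow> ('d, 'd) cochain"
  where
  "partial_comp m n i f g T xs =
     (if T \<in> trees (m + n - 1) \<and> length xs = m + n - 1
      then f (R_outer m i n T)
             (take (i - 1) xs @ [g (R_inner m i n T) (take n (drop (i - 1) xs))]
               @ drop (i - 1 + n) xs)
      else 0)"

definition gbracket ::
  "nat \<Rightarrow> nat \<Rightarrow> ('d::ab_group_add, 'd) cochain \<Rightarrow> ('d, 'd) cochain \<Rightarrow> ('d, 'd) cochain" where
  "gbracket m n f g T xs =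
     (\<Sum>i = 1..m. signed ((i - 1) * (n - 1)) (partial_comp m n i f g T xs))
     - signed ((m - 1) * (n - 1))
         (\<Sum>i = 1..n. signed ((i - 1) * (m - 1)) (partial_comp n m i g f T xs))"


text \<open>
  Elements of the direct sum of \<open>A\<close> and \<open>B\<close> are pairs. A cochain from \<open>B\<close> to \<open>A\<close> is extended to
  the sum by zero, that is, through the projection to \<open>B\<close> and the inclusion of \<open>A\<close>.
\<close>

definition extend :: "('b, 'a) cochain \<Rightarrow> ('a \<times> 'b::zero, 'a \<times> 'b) cochain" where
  "extend f T zs = (f T (map snd zs), 0)"

definition pi_cochain ::
  "('k \<Rightarrow> 'b::ring \<Rightarrow> 'b) \<Rightarrow> ('a::ring \<Rightarrow> 'b \<Rightarrow> 'b) \<Rightarrow> ('b \<Rightarrow> 'a \<Rightarrow> 'b) \<Rightarrow> 'k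
    \<Rightarrow> ('a \<times> 'b, 'a \<times> 'b) cochain" where
  "pi_cochain sB lact ract lam T zs =
     (case zs of
        [(a, x), (b, y)] \<Rightarrow>
          if T = T_dashv then (a * b, ract x b)
          else if T = T_vdash then (a * b, lact a y)
          else if T = T_perp then (a * b, sB lam (x * y))
          else 0
      | _ \<Rightarrow> 0)"

text \<open>
  The bracket of \<open>f\<close> and \<open>g\<close>, of degrees \<open>m\<close> and \<open>n\<close>, is the cochain from \<open>B\<close> to \<open>A\<close> whose
  extension by zero is the iterated bracket with the structure cochain. It is unspecified should
  the iterated bracket not be such an extension.
\<close>

definition derived_bracket ::
  "('k::field \<Rightarrow> 'a::ring \<Rightarrow> 'a) \<Rightarrow> ('k \<Rightarrow> 'b::ring \<Rightarrow> 'b) \<Rightarrow> ('a \<Rightarrow> 'b \<Rightarrow> 'b) \<Rightarrow> ('b \<Rightarrow> 'a \<Rightarrow> 'b)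
    \<Rightarrow> 'k \<Rightarrow> nat \<Rightarrow> nat \<Rightarrow> ('b, 'a) cochain \<Rightarrow> ('b, 'a) cochain \<Rightarrow> ('b, 'a) cochain" where
  "derived_bracket sA sB lact ract lam m n f g =
     the_inv_into (cochains sB sA (m + n)) extend
       (\<lambda>T zs. signed m
          (gbracket (m + 1) n
             (gbracket 2 m (pi_cochain sB lact ract lam) (extend f)) (extend g) T zs))"

definition perp_mult :: "('k \<Rightarrow> 'b::ring \<Rightarrow> 'b) \<Rightarrow> 'k \<Rightarrow> ptree \<Rightarrow> 'b \<Rightarrow> 'b \<Rightarrow> 'b" where
  "perp_mult sB lam S x y = (if S = T_perp then sB lam (x * y) else 0)"

definition cochain_diff ::
  "('k \<Rightarrow> 'b::ring \<Rightarrow> 'b) \<Rightarrow> 'k \<Rightarrow> nat \<Rightarrow> ('b, 'a::ab_group_add) cochain \<Rightarrow> ('b, 'a) cochain"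
  where
  "cochain_diff sB lam n f T xs =
     (if T \<in> trees (n + 1) \<and> length xs = n + 1
      then signed (n - 1)
        (\<Sum>i = 1..n. signed (i - 1)
           (f (face i T)
              (take (i - 1) xs
                @ [perp_mult sB lam (R_inner n i 2 T) (xs ! (i - 1)) (xs ! i)]
                @ drop (i + 1) xs)))
      else 0)"

text \<open>A map from \<open>B\<close> to \<open>A\<close> as a cochain of degree one; \<open>trees 1\<close> has a single element.\<close>

definition cochain_of_map :: "('b \<Rightarrow> 'a::zero) \<Rightarrow> ('b, 'a) cochain" where
  "cochain_of_map P T xs = (if T \<in> trees 1 \<and> length xs = 1 then P (hd xs) else 0)"

definition twisted_diff ::
  "('k::field \<Rightarrow> 'a::ring \<Rightarrow> 'a) \<Rightarrow> ('k \<Rightarrow> 'b::ring \<Rightarrow> 'b) \<Rightarrow> ('a \<Rightarrow> 'b \<Rightarrow> 'b) \<Rightarrow> ('b \<Rightarrow> 'a \<Rightarrow> 'b)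
    \<Rightarrow> 'k \<Rightarrow> ('b \<Rightarrow> 'a) \<Rightarrow> nat \<Rightarrow> ('b, 'a) cochain \<Rightarrow> ('b, 'a) cochain" where
  "twisted_diff sA sB lact ract lam P n f T xs =
     cochain_diff sB lam n f T xs
     + derived_bracket sA sB lact ract lam 1 n (cochain_of_map P) f T xs"

end

theory Submission
  imports Defs
begin

text \<open>
  On \<open>A \<oplus> B\<close>, the cochain \<open>M = [\<pi>, P] + (0, \<lambda> x y)\<close> of degree two consists of three products, one for
  each tree in \<open>trees 2\<close>, and the averaging identities say that they satisfy the eleven axioms of a
  triassociative algebra, one for each tree in \<open>trees 3\<close>. Up to extension by zero, \<open>d\<^sub>P f\<close> is
  \<open>- [M, f]\<close>, which is up to sign an alternating sum of \<open>n + 2\<close> cofaces. The eleven axioms are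
  exactly what makes adjacent cofaces satisfy the cosimplicial identities; for cofaces that are not
  adjacent they hold because deletions of leaves commute. Hence \<open>d\<^sub>P \<circ> d\<^sub>P = 0\<close>.
\<close>

text \<open>Deriving \<open>d_P \<circ> d_P = 0\<close> from a Maurer-Cartan equation would call for
  the graded Jacobi identity for arbitrary tree-indexed cochains. Only brackets with one cochain
  \<open>M\<close> of degree two occur here, so \<open>[M, [M, f]]\<close> is expanded directly into
  a double sum that cancels in pairs. The summand \<open>(0, \<lambda> x y)\<close> has to be added
  by hand: \<open>[\<pi>, P]\<close> has no \<open>B\<close> component on \<open>T_perp\<close>, and
  bracketing with this summand is what produces \<open>df\<close>. Both parts of
  \<open>d_P f\<close> come with a minus sign, \<open>df\<close> by its own sign convention and the
  derived bracket from the factor (-1)^m with m = 1. A further obstacle is that the derived bracket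
  is defined by inverting extension by zero, so \<open>[[\<pi>, P], f]\<close> must be shown to be
  such an extension. This holds because, for the product \<open>[\<pi>, P]\<close>, \<open>A\<close>
  is an ideal with zero multiplication.\<close>

section \<open>Deletion of leaves\<close>

lemma length_prune_le: "length (prune S k T) \<le> 1"
  by (cases T) (auto simp: Let_def)

lemma length_prune_list_single: "length (prune_list S k ts) \<le> 1" if "length ts \<le> 1"
  using that by (cases ts) (auto simp: length_prune_le[simplified])

lemma leaf_count_prune:
  "sum_list (map leaf_count (prune S k T)) = card ({k..<k + leaf_count T} - S)"
  "sum_list (map leaf_count (prune_list S k ts)) = card ({k..<k + sum_list (map leaf_count ts)} - S)"
proof (induction S k T and S k ts rule: prune_prune_list.induct)
  case (2 S k ts)
  then show ?case by (auto simp: Let_def)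
next
  case (4 S k t ts)
  have "{k..<k + (leaf_count t + sum_list (map leaf_count ts))} - S
     = ({k..<k + leaf_count t} - S) \<union> ({k + leaf_count t..<k + leaf_count t + sum_list (map leaf_count ts)} - S)"
    by auto
  then show ?case
    by (simp only: list.map sum_list.Cons prune_list.simps map_append sum_list.append 4)
      (subst card_Un_disjoint, auto)
qed (auto simp: insert_Diff_if)

lemma reduced_prune:
  "reduced T \<Longrightarrow> list_all reduced (prune S k T)"
  "list_all reduced ts \<Longrightarrow> list_all reduced (prune_list S k ts)"
proof (induction S k T and S k ts rule: prune_prune_list.induct)
  case (2 S k ts)
  then have "list_all reduced (prune_list S k ts)" by (simp add: list_all_iff)
  then show ?case by (simp add: Let_def list_all_iff)
qed simp_all

text \<open>
  After the deletion of \<open>S\<close>, the leaf \<open>j\<close> gets the number \<open>k' + card ({k..<j} - S)\<close>.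
\<close>

lemma prune_prune:
  "(\<And>j. \<lbrakk>k \<le> j; j < k + leaf_count T\<rbrakk> \<Longrightarrow> j \<in> S'' \<longleftrightarrow> j \<in> S \<or> k' + card ({k..<j} - S) \<in> S')
    \<Longrightarrow> prune_list S' k' (prune S k T) = prune S'' k T"
  "(\<And>j. \<lbrakk>k \<le> j; j < k + sum_list (map leaf_count ts)\<rbrakk>
      \<Longrightarrow> j \<in> S'' \<longleftrightarrow> j \<in> S \<or> k' + card ({k..<j} - S) \<in> S')
    \<Longrightarrow> prune_list S' k' (prune_list S k ts) = prune_list S'' k ts"
proof (induction S k T and S k ts arbitrary: k' and k' rule: prune_prune_list.induct)
  case (1 S k)
  from 1[of k] show ?case by auto
next
  case (2 S k ts)
  have *: "prune_list S' k' (prune_list S k ts) = prune_list S'' k ts"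
    using 2 by simp
  show ?case
  proof (cases "length (prune_list S k ts) \<le> 1")
    \<comment> \<open>The first deletion already suppresses the vertex. Further deletions keep at
      most one subtree, so deleting \<open>S''\<close> at once suppresses it too.\<close>
    case True
    then have "length (prune_list S'' k ts) \<le> 1"
      using * length_prune_list_single by metis
    then show ?thesis using True * by (simp add: Let_def)
  next
    case False
    then show ?thesis using * by (simp add: Let_def)
  qed
next
  case (3 S k)
  show ?case by simp
next
  case (4 S k t ts)
  let ?c = "card ({k..<k + leaf_count t} - S)"
  have app: "prune_list S' l (us @ vs)
      = prune_list S' l us @ prune_list S' (l + sum_list (map leaf_count us)) vs" for l us vs
    by (induction us arbitrary: l) (auto simp: add.assoc)
  have "prune_list S' k' (prune S k t) = prune S'' k t"
    using 4(1)[of k'] 4(3) by simp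
  moreover have "prune_list S' (k' + ?c) (prune_list S (k + leaf_count t) ts)
     = prune_list S'' (k + leaf_count t) ts"
  proof (rule 4(2))
    fix j assume j: "k + leaf_count t \<le> j" "j < k + leaf_count t + sum_list (map leaf_count ts)"
    have "{k..<j} - S = ({k..<k + leaf_count t} - S) \<union> ({k + leaf_count t..<j} - S)"
      using j by auto
    then have "card ({k..<j} - S) = ?c + card ({k + leaf_count t..<j} - S)"
      by (simp only:) (subst card_Un_disjoint, auto)
    then show "j \<in> S'' \<longleftrightarrow> j \<in> S \<or> k' + ?c + card ({k + leaf_count t..<j} - S) \<in> S'"
      using 4(3)[of j] j by (simp add: add.assoc)
  qed
  ultimately show ?case
    by (simp add: app leaf_count_prune)
qed

lemma leaf_count_pos: "reduced T \<Longrightarrow> 0 < leaf_count T"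
proof (induction T rule: leaf_count.induct)
  case (2 ts)
  then obtain t us where "ts = t # us" by (cases ts) auto
  with 2 show ?case by auto
qed auto

text \<open>\<open>delete_leaves\<close> takes the head of a list, which is meaningful only if a
  leaf survives; hence the condition on surviving leaves here and in the rule for iterated
  deletion.\<close>

lemma prune_delete_leaves:
  assumes "{..<leaf_count T} - S \<noteq> {}"
  shows "prune S 0 T = [delete_leaves S T]"
proof -
  have "card ({..<leaf_count T} - S) \<noteq> 0" using assms by simp
  then have "prune S 0 T \<noteq> []"
    using leaf_count_prune(1)[of S 0 T] by (metis add_0 lessThan_atLeast0 list.map(1) sum_list.Nil)
  then show ?thesis using length_prune_le[of S 0 T]
    by (cases "prune S 0 T") (auto simp: delete_leaves_def)
qed

lemma delete_leaves_trees:
  assumes "T \<in> trees N" "card ({..N} - S) = m + 1"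
  shows "delete_leaves S T \<in> trees m"
proof -
  have N: "{..<leaf_count T} = {..N}" using assms(1) by (auto simp: trees_def)
  then have p: "prune S 0 T = [delete_leaves S T]"
    using assms(2) by (intro prune_delete_leaves) (metis card.empty add_is_0 one_neq_zero)
  show ?thesis
    using leaf_count_prune(1)[of S 0 T] reduced_prune(1)[of T S 0] assms N
    by (auto simp: p trees_def lessThan_atLeast0)
qed

text \<open>The leaf \<open>j\<close> carries the number \<open>card ({..<j} - S)\<close> once
  \<open>S\<close> is gone. Identities between faces and shapes reduce in this way to arithmetic
  with leaf numbers.\<close>

lemma delete_leaves_delete_leaves:
  assumes "T \<in> trees N" "{..N} - S'' \<noteq> {}"
    and "\<And>j. j \<le> N \<Longrightarrow> j \<in> S'' \<longleftrightarrow> j \<in> S \<or> card ({..<j} - S) \<in> S'"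
  shows "delete_leaves S' (delete_leaves S T) = delete_leaves S'' T"
proof -
  have N: "{..<leaf_count T} = {..N}" using assms(1) by (auto simp: trees_def)
  have lc: "leaf_count T = Suc N" using assms(1) by (auto simp: trees_def)
  have 1: "prune S'' 0 T = [delete_leaves S'' T]"
    using assms(2) N by (intro prune_delete_leaves) auto
  have "{..N} - S \<noteq> {}" using assms(2,3) by auto
  then have 2: "prune S 0 T = [delete_leaves S T]"
    using N by (intro prune_delete_leaves) auto
  have "prune_list S' 0 (prune S 0 T) = prune S'' 0 T"
    using assms(3) lc by (intro prune_prune) (auto simp: lessThan_atLeast0)
  then have "prune S' 0 (delete_leaves S T) = [delete_leaves S'' T]" by (simp add: 1 2)
  then show ?thesis by (simp add: delete_leaves_def)
qed

text \<open>\<open>prune_prune\<close> constrains the final set only on leaves that are present, so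
  a second deletion of nothing gives congruence without another induction.\<close>

lemma prune_cong:
  assumes "\<And>j. \<lbrakk>k \<le> j; j < k + leaf_count T\<rbrakk> \<Longrightarrow> j \<in> S \<longleftrightarrow> j \<in> S'"
  shows "prune S k T = prune S' k T"
proof -
  have "prune_list {} 0 (prune S k T) = prune S' k T"
    by (rule prune_prune) (simp add: assms)
  moreover have "prune_list {} 0 (prune S k T) = prune S k T"
    by (rule prune_prune) simp
  ultimately show ?thesis by simp
qed

lemma delete_leaves_cong:
  assumes "T \<in> trees N" "{..N} - S = {..N} - S'"
  shows "delete_leaves S T = delete_leaves S' T"
proof -
  have "prune S 0 T = prune S' 0 T"
  proof (rule prune_cong)
    fix j assume "j < 0 + leaf_count T"
    then have "j \<in> {..N}" using assms(1) by (simp add: trees_def)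
    then show "j \<in> S \<longleftrightarrow> j \<in> S'" using assms(2) by blast
  qed
  then show ?thesis by (simp add: delete_leaves_def)
qed

section \<open>Enumeration of the reduced trees with at most four leaves\<close>

lemma trees_0: "trees 0 = {Leaf}"
proof -
  have "T = Leaf" if "reduced T" "leaf_count T = 1" for T
  proof (cases T)
    case (Node ts)
    with that obtain t u us where "ts = t # u # us"
      by (cases ts; cases "tl ts") auto
    with that Node leaf_count_pos[of t] leaf_count_pos[of u] show ?thesis by auto
  qed
  then show ?thesis by (auto simp: trees_def)
qed

text \<open>The index is the number of leaves, not one less as in \<open>trees\<close>; this
  explains the shifts in the recursions below.\<close>

definition forests :: "nat \<Rightarrow> ptree list set" where
  "forests N = {ts. list_all reduced ts \<and> sum_list (map leaf_count ts) = N}"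

lemma forests_0: "forests 0 = {[]}"
proof -
  have "ts = []" if "list_all reduced ts" "sum_list (map leaf_count ts) = 0" for ts
    using that leaf_count_pos by (cases ts) force+
  then show ?thesis by (auto simp: forests_def)
qed

lemma Cons_in_forests:
  "t # us \<in> forests N \<longleftrightarrow> (\<exists>m<N. t \<in> trees m \<and> us \<in> forests (N - Suc m))" (is "?L \<longleftrightarrow> ?R")
proof
  assume ?L
  then show ?R
    using leaf_count_pos[of t]
    by (intro exI[of _ "leaf_count t - 1"]) (auto simp: forests_def trees_def)
qed (auto simp: forests_def trees_def)

lemma forests_Suc:
  "forests (Suc N) = (\<Union>m\<le>N. \<Union>t\<in>trees m. (#) t ` forests (N - m))"
proof (rule set_eqI)
  fix ts
  show "ts \<in> forests (Suc N) \<longleftrightarrow> ts \<in> (\<Union>m\<le>N. \<Union>t\<in>trees m. (#) t ` forests (N - m))"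
  proof (cases ts)
    case Nil
    then show ?thesis by (auto simp: forests_def)
  next
    case (Cons t us)
    then show ?thesis by (auto simp: Cons_in_forests less_Suc_eq_le)
  qed
qed

text \<open>Splits off the leftmost subtree. The bound \<open>m \<le> n\<close> leaves at least one
  leaf for the others, which is the condition of two or more edges at the root. As a rewrite rule
  this computes \<open>trees\<close> for small indices.\<close>

lemma trees_Suc:
  "trees (Suc n) = (\<Union>m\<le>n. \<Union>t\<in>trees m. (\<lambda>us. Node (t # us)) ` forests (Suc n - m))"
proof (rule set_eqI)
  fix T
  show "T \<in> trees (Suc n) \<longleftrightarrow> T \<in> (\<Union>m\<le>n. \<Union>t\<in>trees m. (\<lambda>us. Node (t # us)) ` forests (Suc n - m))"
  proof (cases T)
    case Leaf
    then show ?thesis by (auto simp: trees_def)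
  next
    case (Node ts)
    have iff: "T \<in> trees (Suc n) \<longleftrightarrow> 2 \<le> length ts \<and> ts \<in> forests (Suc (Suc n))"
      by (auto simp: Node trees_def forests_def list_all_iff)
    show ?thesis
    proof (cases ts)
      case Nil
      then show ?thesis using iff Node by auto
    next
      case (Cons t us)
      have "us \<noteq> [] \<longleftrightarrow> 0 < k" if "us \<in> forests k" for k
      proof
        assume "0 < k"
        then show "us \<noteq> []" using that by (auto simp: forests_def)
      next
        assume "us \<noteq> []"
        then show "0 < k" using that forests_0 by (cases k) auto
      qed
      moreover have "2 \<le> length (t # us) \<longleftrightarrow> us \<noteq> []" by (cases us) auto
      ultimately have "T \<in> trees (Suc n) \<longleftrightarrow> (\<exists>m<Suc n. t \<in> trees m \<and> us \<in> forests (Suc n - m))"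
        unfolding iff Cons Cons_in_forests diff_Suc_Suc
        by (metis less_SucI zero_less_diff)
      then show ?thesis by (auto simp: Node Cons less_Suc_eq_le)
    qed
  qed
qed

lemma trees_1: "trees (Suc 0) = {Node [Leaf, Leaf]}"
  by (simp add: trees_Suc trees_0 forests_Suc forests_0)

lemma trees_2: "trees 2 = {T_dashv, T_vdash, T_perp}"
  unfolding numeral_2_eq_2
  by (auto simp: trees_Suc trees_1 trees_0 forests_Suc forests_0 atMost_Suc
      T_dashv_def T_vdash_def T_perp_def)

lemma trees_3:
  "trees 3 = {Node [Leaf, T_dashv], Node [Leaf, T_vdash], Node [Leaf, T_perp],
     Node [Node [Leaf, Leaf], Node [Leaf, Leaf]],
     Node [T_dashv, Leaf], Node [T_vdash, Leaf], Node [T_perp, Leaf],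
     Node [Leaf, Leaf, Node [Leaf, Leaf]], Node [Leaf, Node [Leaf, Leaf], Leaf],
     Node [Node [Leaf, Leaf], Leaf, Leaf], Node [Leaf, Leaf, Leaf, Leaf]}"
proof -
  have 2: "trees (Suc (Suc 0)) = {T_dashv, T_vdash, T_perp}"
    using trees_2 by (simp add: numeral_2_eq_2)
  show ?thesis
    unfolding numeral_3_eq_3
    by (auto simp: trees_Suc[of "Suc (Suc 0)"] 2 trees_1 trees_0 forests_Suc forests_0 atMost_Suc)
qed

section \<open>Faces, and the trees spanned by three or four leaves\<close>

lemma face_trees: "face i T \<in> trees N" if "T \<in> trees (Suc N)" "i \<le> Suc N"
  unfolding face_def using that by (intro delete_leaves_trees) auto

lemma card_lessThan_Diff_singleton: "card ({..<k::nat} - {j}) = (if j < k then k - 1 else k)"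
  by simp

text \<open>Both sides delete the leaves \<open>i\<close> and \<open>j\<close> of \<open>T\<close>:
  leaf \<open>j\<close> becomes number \<open>j - 1\<close> once \<open>i\<close> is gone, while
  \<open>i\<close> keeps its number when \<open>j\<close> goes.\<close>

lemma face_face:
  assumes "T \<in> trees (Suc (Suc N))" "i < j" "j \<le> Suc (Suc N)"
  shows "face i (face j T) = face (j - 1) (face i T)"
proof -
  have "card ({..Suc (Suc N)} - {i, j}) \<noteq> 0"
    using assms by (subst card_Diff_subset) auto
  then have ne: "{..Suc (Suc N)} - {i, j} \<noteq> {}" by (metis card.empty)
  have "face i (face j T) = delete_leaves {i, j} T"
    unfolding face_def using assms
    by (intro delete_leaves_delete_leaves[OF _ ne])
      (auto simp: card_lessThan_Diff_singleton split: if_splits)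
  moreover have "face (j - 1) (face i T) = delete_leaves {i, j} T"
    unfolding face_def using assms
    by (intro delete_leaves_delete_leaves[OF _ ne])
      (auto simp: card_lessThan_Diff_singleton split: if_splits)
  ultimately show ?thesis by simp
qed

text \<open>For leaves \<open>a < b < c\<close> of \<open>T\<close> this is the tree in
  \<open>trees 2\<close> that they span; it selects one of the three products. Numbers that no leaf
  carries do not affect \<open>prune\<close>, so the full complement may be deleted.\<close>

definition shape :: "ptree \<Rightarrow> nat \<Rightarrow> nat \<Rightarrow> nat \<Rightarrow> ptree" where
  "shape T a b c = delete_leaves (- {a, b, c}) T"

lemma shape_face:
  assumes "T \<in> trees (Suc N)" "a < b" "b < c" "c \<le> N" "j \<le> Suc N"
  shows "shape (face j T) a b c
    = shape T (if a < j then a else Suc a) (if b < j then b else Suc b) (if c < j then c else Suc c)"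
  unfolding face_def shape_def using assms(2-5)
  by (intro delete_leaves_delete_leaves[OF assms(1)])
    (auto simp: card_lessThan_Diff_singleton simp del: card_Diff_insert split: if_splits)

text \<open>Axioms indexed by \<open>trees 3\<close> become applicable inside a tree of any size:
  four of its leaves span \<open>Q\<close>, and the faces of \<open>Q\<close> are the shapes on
  three of the four.\<close>

lemma face_delete_all_but_four:
  assumes "T \<in> trees N" "a < b" "b < c" "c < d" "d \<le> N"
  defines "Q \<equiv> delete_leaves (- {a, b, c, d}) T"
  shows "Q \<in> trees 3" "face 0 Q = shape T b c d" "face 1 Q = shape T a c d"
    "face 2 Q = shape T a b d" "face 3 Q = shape T a b c"
proof -
  have "{..N} - - {a, b, c, d} = {a, b, c, d}" using assms by auto
  then show "Q \<in> trees 3" unfolding Q_def using assms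
    by (intro delete_leaves_trees[of _ N]) auto
  have card: "card ({..<j} - - {a, b, c, d})
      = (if a < j then 1 else 0) + (if b < j then 1 else 0) + (if c < j then 1 else 0) + (if d < j then 1 else 0)" for j
  proof -
    have "{..<j} - - {a, b, c, d} = {x \<in> {a, b, c, d}. x < j}" by auto
    then have "card ({..<j} - - {a, b, c, d}) = (\<Sum>x\<in>{a, b, c, d}. if x < j then 1 else 0)"
      by (simp only: card_eq_sum sum.inter_filter finite.intros)
    then show ?thesis using assms by simp
  qed
  show "face 0 Q = shape T b c d" "face 1 Q = shape T a c d"
    "face 2 Q = shape T a b d" "face 3 Q = shape T a b c"
    unfolding Q_def face_def shape_def
    by (rule delete_leaves_delete_leaves[OF assms(1)]; use assms(2-5) in \<open>auto simp: card\<close>)+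
qed

section \<open>Cofaces of a triassociative product\<close>

lemma signed_0_left [simp]: "signed 0 v = v" and signed_Suc: "signed (Suc k) v = - signed k v"
  and signed_zero [simp]: "signed k 0 = 0"
  and signed_add: "signed k (u + v) = signed k u + signed k v"
  and signed_minus: "signed k (- v) = - signed k v"
  and signed_signed: "signed k (signed l v) = signed (k + l) v"
  by (auto simp: signed_def)

lemma signed_sum: "signed k (\<Sum>x\<in>X. g x) = (\<Sum>x\<in>X. signed k (g x))"
  by (simp add: signed_def sum_negf)

lemma signed_cong: "even k = even l \<Longrightarrow> signed k v = signed l v"
  by (simp add: signed_def)

text \<open>Sending \<open>(j, i)\<close> to \<open>(i, j - 1)\<close> matches the pairs with
  \<open>i < j\<close> with all the others. Matched summands agree, and their exponents differ by
  one.\<close>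

lemma cosimplicial_sum_eq_0:
  assumes "\<And>i j. \<lbrakk>i < j; j \<le> Suc N\<rbrakk> \<Longrightarrow> a j i = a i (j - 1)"
  shows "(\<Sum>j\<le>Suc N. \<Sum>i\<le>N. signed (j + i) (a j i)) = 0"
proof -
  let ?S = "{..Suc N} \<times> {..N}"
  let ?g = "\<lambda>(j, i). signed (j + i) (a j i)"
  let ?L = "{(j, i) \<in> ?S. i < j}" and ?U = "{(j, i) \<in> ?S. \<not> i < j}"
  have "sum ?g ?L = (\<Sum>p\<in>?U. - ?g p)"
  proof (rule sum.reindex_bij_witness[where i = "\<lambda>(j, i). (Suc i, j)" and j = "\<lambda>(j, i). (i, j - 1)"])
    fix p assume "p \<in> ?L"
    then obtain j i where p: "p = (Suc j, i)" "i \<le> j" "j \<le> N"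
      by (cases p; cases "fst p") auto
    then show "- ?g (case p of (j, i) \<Rightarrow> (i, j - 1)) = ?g p"
      using assms[of i "Suc j"] by (simp add: signed_Suc add.commute)
  qed auto
  moreover have "sum ?g ?S = sum ?g ?L + sum ?g ?U"
    using sum.Int_Diff[of ?S ?g "{(j, i). i < j}"]
    by (auto intro!: arg_cong2[where f = "(+)"] sum.cong)
  ultimately have "sum ?g ?S = 0" by (simp add: sum_negf)
  then show ?thesis by (simp add: sum.cartesian_product)
qed

text \<open>Read the entries as the gaps between consecutive leaves: \<open>zs ! (i - 1)\<close> and
  \<open>zs ! i\<close> are the gaps on the two sides of leaf \<open>i\<close>, so merging them goes
  with \<open>face i\<close>.\<close>

definition merge :: "nat \<Rightarrow> 'e \<Rightarrow> 'e list \<Rightarrow> 'e list" where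
  "merge i y zs = take (i - 1) zs @ y # drop (i + 1) zs"

lemma length_merge [simp]: "1 \<le> i \<Longrightarrow> i < length zs \<Longrightarrow> length (merge i y zs) = length zs - 1"
  by (simp add: merge_def)

lemma nth_merge:
  assumes "1 \<le> i" "i < length zs" "k < length zs - 1"
  shows "merge i y zs ! k = (if k < i - 1 then zs ! k else if k = i - 1 then y else zs ! Suc k)"
  using assms by (auto simp: merge_def nth_append nth_Cons split: nat.split)
    (auto intro!: arg_cong[where f = "(!) zs"])

text \<open>
  The leaves of \<open>T\<close> are read cyclically: the product inserted by the \<open>i\<close>-th coface has the shape of
  \<open>T\<close> on the leaves \<open>i - 1\<close>, \<open>i\<close>, \<open>i + 1\<close> modulo \<open>n + 2\<close>.
\<close>

definition coface ::
  "('e, 'e) cochain \<Rightarrow> nat \<Rightarrow> nat \<Rightarrow> ('e, 'e) cochain \<Rightarrow> ('e, 'e) cochain" where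
  "coface M n i f T zs =
     (if i = 0 then M (shape T 0 1 (n + 1)) [zs ! 0, f (face 0 T) (tl zs)]
      else if i = n + 1 then M (shape T 0 n (n + 1)) [f (face (n + 1) T) (butlast zs), zs ! n]
      else f (face i T)
        (merge i (M (shape T (i - 1) i (i + 1)) [zs ! (i - 1), zs ! i]) zs))"

text \<open>The arguments sit in the gaps between the leaves 0, 1, 2, 3 of \<open>Q\<close>.
  Multiplying \<open>v\<close> and \<open>w\<close> uses the leaves 1, 2, 3, that is
  \<open>face 0 Q\<close>, and then removes leaf 2; similarly for \<open>u\<close> and
  \<open>v\<close>. All axioms thus read \<open>M \<circ>_2 M = M \<circ>_1 M\<close>, and
  \<open>[M, M]\<close> is up to sign twice the difference of the two sides.\<close>

definition triassociative :: "('e, 'e) cochain \<Rightarrow> bool" where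
  "triassociative M \<longleftrightarrow> (\<forall>Q \<in> trees 3. \<forall>u v w.
     M (face 2 Q) [u, M (face 0 Q) [v, w]] = M (face 1 Q) [M (face 3 Q) [u, v], w])"

lemma triassociative_shape:
  assumes "triassociative M" "T \<in> trees N" "a < b" "b < c" "c < d" "d \<le> N"
  shows "M (shape T a c d) [M (shape T a b c) [u, v], w]
    = M (shape T a b d) [u, M (shape T b c d) [v, w]]"
  using assms(1) face_delete_all_but_four[OF assms(2-6)] unfolding triassociative_def by metis

lemma coface_coface:
  assumes M: "triassociative M" and T: "T \<in> trees (Suc (Suc n))"
    and len: "length zs = Suc (Suc n)" and n: "1 \<le> n" and ij: "i < j" "j \<le> Suc (Suc n)"
  shows "coface M (Suc n) j (coface M n i f) T zs = coface M (Suc n) i (coface M n (j - 1) f) T zs"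
proof -
  note ff = face_face[OF T ij]
  note sf = shape_face[OF T]
  note tri = triassociative_shape[OF M T]
  note [simp] = len nth_tl nth_butlast nth_merge
  \<comment> \<open>The cofaces are cyclically adjacent in the cases 1, 3, 4 and 6, and only these
    use \<open>tri\<close>. In case 3 the neighbours are the first and the last leaf:
    \<open>f\<close> is multiplied from both ends.\<close>
  consider "i = 0" "j = 1" | "i = 0" "2 \<le> j" "j \<le> Suc n" | "i = 0" "j = Suc (Suc n)"
    | "i = Suc n" "j = Suc (Suc n)" | "1 \<le> i" "i \<le> n" "j = Suc (Suc n)"
    | "1 \<le> i" "j = Suc i" "i \<le> n" | "1 \<le> i" "Suc i < j" "j \<le> Suc n"
    using ij n by linarith
  then show ?thesis
  proof cases
    case 1
    have "tl (merge 1 y zs) = tl (tl zs)" for y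
      using n by (intro nth_equalityI) auto
    then show ?thesis
      using 1 n ff tri[of 0 1 2 "Suc (Suc n)"] by (simp add: coface_def sf numeral_2_eq_2)
  next
    case 2
    then obtain k where k: "j = Suc (Suc k)" by (metis Suc_le_D numeral_2_eq_2 Suc_le_mono)
    have "tl (merge j y zs) = merge (j - 1) y (tl zs)" for y
      using 2 by (intro nth_equalityI) auto
    then show ?thesis
      using 2 n ff by (simp add: coface_def sf k)
  next
    case 3
    have "tl (butlast zs) = butlast (tl zs)" by (simp add: butlast_tl)
    then show ?thesis
      using 3 n ff tri[of 0 1 "Suc n" "Suc (Suc n)"] by (simp add: coface_def sf)
  next
    case 4
    have "butlast (merge (Suc n) y zs) = butlast (butlast zs)" for y
      using n by (intro nth_equalityI) auto
    then show ?thesis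
      using 4 n ff tri[of 0 n "Suc n" "Suc (Suc n)"] by (simp add: coface_def sf)
  next
    case 5
    then obtain l where l: "i = Suc l" by (cases i) auto
    have "butlast (merge i y zs) = merge i y (butlast zs)" for y
      using 5 by (intro nth_equalityI) auto
    then show ?thesis
      using 5 n ff by (simp add: coface_def sf l)
  next
    case 6
    then obtain l where l: "i = Suc l" by (cases i) auto
    have "merge (Suc l) y (merge (Suc (Suc l)) y' zs) = take l zs @ y # drop (l + 3) zs"
      "merge (Suc l) y (merge (Suc l) y' zs) = take l zs @ y # drop (l + 3) zs" for y y'
      using 6 l by (simp_all add: merge_def numeral_3_eq_3)
    then show ?thesis
      using 6 n ff tri[of l i "Suc i" "Suc (Suc i)"] by (simp add: coface_def sf l)
  next
    case 7
    then obtain l k where lk: "i = Suc l" "j = Suc (Suc k)"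
      by (cases i; cases j; cases "j - 1") auto
    have "merge i y (merge j y' zs) = merge (j - 1) y' (merge i y zs)" for y y'
      using 7 n by (intro nth_equalityI) auto
    then show ?thesis
      using 7 n ff by (simp add: coface_def sf lk)
  qed
qed

section \<open>The bracket with a cochain of degree two as an alternating sum of cofaces\<close>

lemma signed_double: "signed (k + k) v = v"
  by (simp add: signed_def)

lemma R_outer_2_1: "R_outer 2 1 n T = shape T 0 n (Suc n)"
  and R_inner_2_1: "R_inner 2 1 n T = face (Suc n) T"
  and R_outer_2_2: "R_outer 2 2 n T = shape T 0 1 (Suc n)"
  and R_inner_2_2: "R_inner 2 2 n T = face 0 T"
  if "T \<in> trees (Suc n)" "1 \<le> n"
  unfolding R_outer_def R_inner_def shape_def face_def using that(2)
  by (auto intro!: delete_leaves_cong[OF that(1)])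

lemma R_outer_2_face: "R_outer n i 2 T = face i T"
  by (simp add: R_outer_def face_def)

lemma R_inner_2_shape:
  assumes "T \<in> trees (Suc n)" "1 \<le> i" "i \<le> n"
  shows "R_inner n i 2 T = shape T (i - 1) i (i + 1)"
  unfolding R_inner_def shape_def using assms(2,3)
  by (intro delete_leaves_cong[OF assms(1)]) auto

text \<open>In \<open>[M, f]\<close> the terms \<open>M \<circ>_1 f\<close> and
  \<open>M \<circ>_2 f\<close> are the last and the first coface, and \<open>f \<circ>_i M\<close>
  is the \<open>i\<close>-th. The result is a coboundary of Hochschild type, up to the global sign
  (-1)^(n+1).\<close>

lemma gbracket_eq_coface_sum:
  assumes T: "T \<in> trees (Suc n)" and len: "length zs = Suc n" and n: "1 \<le> n"
  shows "gbracket 2 n M f T zs = signed (Suc n) (\<Sum>i\<le>Suc n. signed i (coface M n i f T zs))"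
proof -
  have butlast: "butlast zs = take n zs" using len by (simp add: butlast_conv_take)
  have drop_n: "drop n zs = [zs ! n]"
    using len by (metis Cons_nth_drop_Suc drop_all lessI order_refl)
  have "partial_comp 2 n 1 M f T zs = coface M n (Suc n) f T zs"
    using T len n R_outer_2_1[OF T n] R_inner_2_1[OF T n]
    by (simp add: partial_comp_def coface_def butlast drop_n)
  moreover have "partial_comp 2 n 2 M f T zs = coface M n 0 f T zs"
    using T len n R_outer_2_2[OF T n] R_inner_2_2[OF T n]
    by (cases zs) (simp_all add: partial_comp_def coface_def)
  moreover have "partial_comp n 2 i f M T zs = coface M n i f T zs" if "i \<in> {1..n}" for i
  proof -
    have "take 2 (drop (i - 1) zs) = [zs ! (i - 1), zs ! i]"
      using that len by (intro nth_equalityI) (auto simp: numeral_2_eq_2 less_Suc_eq)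
    then show ?thesis
      using that T len n R_inner_2_shape[OF T, of i]
      by (auto simp: partial_comp_def coface_def R_outer_2_face merge_def)
  qed
  moreover have "(\<Sum>i = 1..n. signed (i - 1) (coface M n i f T zs))
      = - (\<Sum>i = 1..n. signed i (coface M n i f T zs))" (is "_ = - ?X")
    unfolding sum_negf[symmetric]
    by (intro sum.cong refl) (auto simp: signed_Suc gr0_conv_Suc Suc_le_eq)
  moreover have "(\<Sum>i\<le>Suc n. signed i (coface M n i f T zs))
      = coface M n 0 f T zs + ?X + signed (Suc n) (coface M n (Suc n) f T zs)"
  proof -
    have "{..Suc n} = insert 0 (insert (Suc n) {1..n})" by auto
    then show ?thesis by (simp add: ac_simps del: sum.atMost_Suc)
  qed
  moreover have "{Suc 0..Suc (Suc 0)} = {Suc 0, Suc (Suc 0)}" by auto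
  moreover obtain k where "n = Suc k" using n by (cases n) auto
  ultimately show ?thesis
    by (simp add: gbracket_def numeral_2_eq_2 signed_Suc signed_add signed_minus signed_signed
        signed_double del: sum.cl_ivl_Suc sum.atMost_Suc)
qed

definition biadditive :: "('e::ab_group_add, 'e) cochain \<Rightarrow> bool" where
  "biadditive M \<longleftrightarrow> (\<forall>S u. additive (\<lambda>v. M S [u, v]) \<and> additive (\<lambda>v. M S [v, u]))"

lemma signed_additive: "additive h \<Longrightarrow> h (signed k v) = signed k (h v)"
  by (simp add: signed_def additive.minus)

text \<open>The two extreme cofaces feed the sum into \<open>M\<close>, where biadditivity takes it
  out again; in the inner ones it is already outermost.\<close>

lemma coface_sum:
  assumes "biadditive M"
  shows "coface M n i (\<lambda>T zs. signed k (\<Sum>x\<in>X. signed (e x) (g x T zs))) T zs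
    = signed k (\<Sum>x\<in>X. signed (e x) (coface M n i (g x) T zs))"
proof -
  have h: "h (signed k (\<Sum>x\<in>X. signed (e x) (g x T zs)))
    = signed k (\<Sum>x\<in>X. signed (e x) (h (g x T zs)))" if "additive h" for h T zs
    using that by (simp add: signed_additive additive.sum)
  note h1 = h[of "\<lambda>v. M S [v, u]" for S u] and h2 = h[of "\<lambda>v. M S [u, v]" for S u]
  show ?thesis
    using assms by (simp add: coface_def h1 h2 biadditive_def)
qed

lemma coface_cong:
  assumes "\<And>T zs. T \<in> trees n \<Longrightarrow> length zs = n \<Longrightarrow> f T zs = g T zs"
    and "T \<in> trees (Suc n)" "length zs = Suc n" "i \<le> Suc n"
  shows "coface M n i f T zs = coface M n i g T zs"
  using assms face_trees[OF assms(2)] by (auto simp: coface_def)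

lemma gbracket_outside:
  assumes "T \<notin> trees (m + n - 1) \<or> length zs \<noteq> m + n - 1"
  shows "gbracket m n f g T zs = 0"
  using assms by (auto simp: gbracket_def partial_comp_def add.commute)

text \<open>The sign \<open>k\<close> is there because the differential is \<open>- [M, f]\<close>
  rather than \<open>[M, f]\<close>.\<close>

lemma gbracket_gbracket_eq_0:
  assumes M: "triassociative M" "biadditive M" and n: "1 \<le> n"
    and g: "\<And>T zs. g T zs = signed k (gbracket 2 n M f T zs)"
  shows "gbracket 2 (Suc n) M g T zs = 0"
proof (cases "T \<in> trees (Suc (Suc n)) \<and> length zs = Suc (Suc n)")
  case True
  then have T: "T \<in> trees (Suc (Suc n))" and len: "length zs = Suc (Suc n)" by auto
  have "coface M (Suc n) j g T zs
      = signed (k + Suc n) (\<Sum>i\<le>Suc n. signed i (coface M (Suc n) j (coface M n i f) T zs))"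
    if "j \<le> Suc (Suc n)" for j
    \<comment> \<open>The expansion of \<open>g\<close> into cofaces holds only on genuine trees and
      lists of the right length, so it is inserted through \<open>coface_cong\<close>.\<close>
    unfolding coface_sum[OF M(2), symmetric]
    using that T len n
    by (intro coface_cong) (simp_all add: g gbracket_eq_coface_sum signed_signed del: sum.atMost_Suc)
  then have "(\<Sum>j\<le>Suc (Suc n). signed j (coface M (Suc n) j g T zs))
      = signed (k + Suc n) (\<Sum>j\<le>Suc (Suc n). \<Sum>i\<le>Suc n.
          signed (j + i) (coface M (Suc n) j (coface M n i f) T zs))"
    by (simp add: signed_sum signed_signed ac_simps del: sum.atMost_Suc)
  also have "\<dots> = 0"
    using coface_coface[OF M(1) T len n]
    by (subst cosimplicial_sum_eq_0) auto
  finally show ?thesis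
    using gbracket_eq_coface_sum[OF T len] by simp
next
  case False
  then show ?thesis by (intro gbracket_outside) auto
qed

section \<open>Cochains on a direct sum\<close>

lemma cochains_linear:
  "f \<in> cochains sD sE n \<Longrightarrow> T \<in> trees n \<Longrightarrow> length xs = n \<Longrightarrow> i < n
    \<Longrightarrow> Vector_Spaces.linear sD sE (\<lambda>x. f T (xs[i := x]))"
  by (auto simp: cochains_def)

lemma R_outer_trees:
  assumes "T \<in> trees (m + n - 1)" "1 \<le> i" "i \<le> m" "1 \<le> n"
  shows "R_outer m i n T \<in> trees m"
proof -
  have "{i..i + n - 2} \<subseteq> {..m + n - 1}" using assms by auto
  then have "card ({..m + n - 1} - {i..i + n - 2}) = m + 1"
    using assms by (subst card_Diff_subset) auto
  then show ?thesis
    unfolding R_outer_def by (rule delete_leaves_trees[OF assms(1)])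
qed

lemma R_inner_trees:
  assumes "T \<in> trees (m + n - 1)" "1 \<le> i" "i \<le> m" "1 \<le> n"
  shows "R_inner m i n T \<in> trees n"
proof -
  have "{..m + n - 1} - ({0..m + n - 1} - {i - 1..i + n - 1}) = {i - 1..i + n - 1}"
    using assms by auto
  then have "card ({..m + n - 1} - ({0..m + n - 1} - {i - 1..i + n - 1})) = n + 1"
    using assms by simp
  then show ?thesis
    unfolding R_inner_def by (rule delete_leaves_trees[OF assms(1)])
qed

lemma partial_comp_cochains:
  fixes s :: "'k::field \<Rightarrow> 'd::ab_group_add \<Rightarrow> 'd"
  assumes f: "f \<in> cochains s s m" and g: "g \<in> cochains s s n"
    and i: "1 \<le> i" "i \<le> m" and n: "1 \<le> n"
  shows "partial_comp m n i f g \<in> cochains s s (m + n - 1)"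
  unfolding cochains_def
proof (intro CollectI conjI allI impI)
  fix T and xs :: "'d list" and j assume T: "T \<in> trees (m + n - 1)" and len: "length xs = m + n - 1" and j: "j < m + n - 1"
  note o = R_outer_trees[OF T i n] and r = R_inner_trees[OF T i n]
  let ?f = "f (R_outer m i n T)" and ?g = "g (R_inner m i n T)"
  let ?h = "\<lambda>xs. take (i - 1) xs @ [?g (take n (drop (i - 1) xs))] @ drop (i - 1 + n) xs"
  have eq: "partial_comp m n i f g T (xs[j := x]) = ?f (?h (xs[j := x]))" for x
    using T len by (simp add: partial_comp_def)
  have lin: "Vector_Spaces.linear s s (\<lambda>x. ?f ((?h xs)[k := x]))" if "k < m" for k
    using that len i n by (intro cochains_linear[OF f o]) auto
  \<comment> \<open>The varied argument stands before, within or after the block consumed by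
    \<open>g\<close>; within it, two linear maps are composed.\<close>
  consider "j < i - 1" | "i - 1 \<le> j" "j < i - 1 + n" | "i - 1 + n \<le> j" by linarith
  then show "Vector_Spaces.linear s s (\<lambda>x. partial_comp m n i f g T (xs[j := x]))"
    unfolding eq
  proof cases
    case 1
    then have "?h (xs[j := x]) = (?h xs)[j := x]" for x
      using j i len by (simp add: take_update_swap drop_update_swap list_update_append)
    then show "Vector_Spaces.linear s s (\<lambda>x. ?f (?h (xs[j := x])))"
      using lin[of j] 1 i by simp
  next
    case 2
    let ?B = "take n (drop (i - 1) xs)"
    have "(take (i - 1) xs)[j := x] = take (i - 1) xs" for x
      using 2 by (intro list_update_beyond) simp
    then have "?h (xs[j := x]) = (?h xs)[i - 1 := ?g (?B[j - (i - 1) := x])]" for x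
      using 2 len i n by (simp add: take_update_swap drop_update_swap list_update_append)
    moreover have glin: "Vector_Spaces.linear s s (\<lambda>x. ?g (?B[j - (i - 1) := x]))"
      using 2 len i n by (intro cochains_linear[OF g r]) auto
    ultimately show "Vector_Spaces.linear s s (\<lambda>x. ?f (?h (xs[j := x])))"
      using Vector_Spaces.linear_compose[OF glin lin[of "i - 1"]] i by (simp add: comp_def)
  next
    case 3
    \<comment> \<open>The names \<open>p\<close> and \<open>q\<close> remove truncated subtractions.
      The block shrinks from \<open>n\<close> entries to one, so entry \<open>j\<close> moves to
      \<open>Suc (j - n)\<close>.\<close>
    then obtain p q where pq: "i = Suc p" "j = p + n + q"
      using i by (metis Suc_le_D One_nat_def diff_Suc_1 le_Suc_ex)
    have "(take p xs)[j := x] = take p xs" "(take n (drop p xs))[n + q := x] = take n (drop p xs)" for x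
      by (auto intro!: list_update_beyond simp: pq)
    then have "?h (xs[j := x]) = (?h xs)[Suc (j - n) := x]" for x
      using len i n by (simp add: pq take_update_swap drop_update_swap list_update_append)
    then show "Vector_Spaces.linear s s (\<lambda>x. ?f (?h (xs[j := x])))"
      using lin[of "Suc (j - n)"] 3 i j n by simp
  qed
qed (auto simp: partial_comp_def)

lemma cochains_zero: "vector_space sD \<Longrightarrow> vector_space sE \<Longrightarrow> (\<lambda>T xs. 0) \<in> cochains sD sE n"
  by (auto simp: cochains_def Vector_Spaces.linear_iff       module_iff_vector_space[symmetric] module.scale_zero_right)

lemma cochains_add:
  "f \<in> cochains sD sE n \<Longrightarrow> g \<in> cochains sD sE n \<Longrightarrow> (\<lambda>T xs. f T xs + g T xs) \<in> cochains sD sE n"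
  by (auto simp: cochains_def Vector_Spaces.linear_iff vector_space_def algebra_simps)

lemma cochains_minus:
  "f \<in> cochains sD sE n \<Longrightarrow> (\<lambda>T xs. - f T xs) \<in> cochains sD sE n"
  by (auto simp: cochains_def Vector_Spaces.linear_iff module_iff_vector_space[symmetric]
      module.scale_minus_right)

lemma cochains_signed:
  "f \<in> cochains sD sE n \<Longrightarrow> (\<lambda>T xs. signed k (f T xs)) \<in> cochains sD sE n"
  by (cases "even k") (simp_all add: signed_def cochains_minus)

lemma cochains_sum:
  assumes "vector_space sD" "vector_space sE" "\<And>i. i \<in> I \<Longrightarrow> f i \<in> cochains sD sE n"
  shows "(\<lambda>T xs. \<Sum>i\<in>I. f i T xs) \<in> cochains sD sE n"
  using assms(3)
  by (induction I rule: infinite_finite_induct) (simp_all add: cochains_zero assms cochains_add)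

lemma gbracket_cochains:
  assumes s: "vector_space s" and f: "f \<in> cochains s s m" and g: "g \<in> cochains s s n"
    and mn: "1 \<le> m" "1 \<le> n"
  shows "gbracket m n f g \<in> cochains s s (m + n - 1)"
proof -
  have "(\<lambda>T xs. (\<Sum>i = 1..m. signed ((i - 1) * (n - 1)) (partial_comp m n i f g T xs))
     + - signed ((m - 1) * (n - 1))
         (\<Sum>i = 1..n. signed ((i - 1) * (m - 1)) (partial_comp n m i g f T xs)))
      \<in> cochains s s (m + n - 1)"
    using partial_comp_cochains[OF f g] partial_comp_cochains[OF g f] mn
    by (intro cochains_add cochains_minus cochains_signed cochains_sum s)
      (auto simp: add.commute)
  moreover have "gbracket m n f g = (\<lambda>T xs. (\<Sum>i = 1..m. signed ((i - 1) * (n - 1)) (partial_comp m n i f g T xs))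
     + - signed ((m - 1) * (n - 1))
         (\<Sum>i = 1..n. signed ((i - 1) * (m - 1)) (partial_comp n m i g f T xs)))"
    by (simp add: gbracket_def fun_eq_iff)
  ultimately show ?thesis by simp
qed

lemma partial_comp_add_right:
  assumes f: "f \<in> cochains s s m" and i: "1 \<le> i" "i \<le> m" and n: "1 \<le> n"
  shows "partial_comp m n i f (\<lambda>T xs. g T xs + h T xs) T xs
    = partial_comp m n i f g T xs + partial_comp m n i f h T xs"
proof (cases "T \<in> trees (m + n - 1) \<and> length xs = m + n - 1")
  case True
  \<comment> \<open>In \<open>?h 0\<close> the entry 0 is a placeholder for the slot that is
    varied.\<close>
  let ?h = "\<lambda>x. take (i - 1) xs @ [x] @ drop (i - 1 + n) xs"
  have "Vector_Spaces.linear s s (\<lambda>x. f (R_outer m i n T) ((?h 0)[i - 1 := x]))"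
    using True i n by (intro cochains_linear[OF f R_outer_trees]) auto
  moreover have "(?h 0)[i - 1 := x] = ?h x" for x
    using True i n by (simp add: list_update_append)
  ultimately show ?thesis
    using True by (simp add: partial_comp_def Vector_Spaces.linear_iff)
next
  case False
  then show ?thesis by (auto simp: partial_comp_def)
qed

lemma gbracket_add_left:
  assumes "g \<in> cochains s s n" "1 \<le> m"
  shows "gbracket m n (\<lambda>T xs. f T xs + f' T xs) g T xs = gbracket m n f g T xs + gbracket m n f' g T xs"
proof -
  have "partial_comp m n i (\<lambda>T xs. f T xs + f' T xs) g T xs
      = partial_comp m n i f g T xs + partial_comp m n i f' g T xs" for i
    by (simp add: partial_comp_def)
  then show ?thesis
    using partial_comp_add_right[OF assms(1) _ _ assms(2)]
    by (simp add: gbracket_def signed_add sum.distrib)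
qed

definition prod_scale :: "('k \<Rightarrow> 'a \<Rightarrow> 'a) \<Rightarrow> ('k \<Rightarrow> 'b \<Rightarrow> 'b) \<Rightarrow> 'k \<Rightarrow> 'a \<times> 'b \<Rightarrow> 'a \<times> 'b" where
  "prod_scale sA sB c = map_prod (sA c) (sB c)"

lemma vector_space_prod_scale:
  "vector_space sA \<Longrightarrow> vector_space sB \<Longrightarrow> vector_space (prod_scale sA sB)"
  by (auto simp: vector_space_def prod_scale_def)

lemma extend_cochains:
  assumes "vector_space sA" "vector_space sB" "f \<in> cochains sB sA n"
  shows "extend f \<in> cochains (prod_scale sA sB) (prod_scale sA sB) n"
  using assms vector_space_prod_scale[OF assms(1,2)]
  by (auto simp: cochains_def extend_def Vector_Spaces.linear_iff map_update prod_scale_def zero_prod_def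
      module.scale_zero_right module_iff_vector_space[symmetric])

text \<open>A left inverse of \<open>extend\<close>: restrict to \<open>B\<close> and project to
  \<open>A\<close>. Injectivity of \<open>extend\<close> and the descent of multilinearity rest on
  it.\<close>

lemma fst_extend: "f T xs = fst (extend f T (map (Pair 0) xs))"
  by (simp add: extend_def comp_def)

lemma extend_cochainsD:
  fixes sA :: "'k::field \<Rightarrow> 'a::ab_group_add \<Rightarrow> 'a" and sB :: "'k \<Rightarrow> 'b::ab_group_add \<Rightarrow> 'b"
  assumes "vector_space sA" "vector_space sB"
    and E: "extend f \<in> cochains (prod_scale sA sB) (prod_scale sA sB) n"
  shows "f \<in> cochains sB sA n"
  unfolding cochains_def
proof (intro CollectI conjI allI impI)
  fix T and xs :: "'b list" and i assume "T \<in> trees n" "length xs = n" "i < n"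
  then have "Vector_Spaces.linear (prod_scale sA sB) (prod_scale sA sB)
      (\<lambda>z. extend f T ((map (Pair 0) xs)[i := z]))"
    by (intro cochains_linear[OF E]) auto
  then have *: "extend f T ((map (Pair 0) xs)[i := z + w])
      = extend f T ((map (Pair 0) xs)[i := z]) + extend f T ((map (Pair 0) xs)[i := w])"
    "extend f T ((map (Pair 0) xs)[i := prod_scale sA sB c z])
      = prod_scale sA sB c (extend f T ((map (Pair 0) xs)[i := z]))" for z w c
    unfolding Vector_Spaces.linear_iff by blast+
  have "sA c 0 = 0" for c
    using assms(1) by (simp add: module_iff_vector_space[symmetric] module.scale_zero_right)
  then have "f T (xs[i := x + y]) = f T (xs[i := x]) + f T (xs[i := y])"
    "f T (xs[i := sB c x]) = sA c (f T (xs[i := x]))" for x y c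
    using *(1)[of "(0, x)" "(0, y)"] *(2)[of c "(0, x)"]
    by (simp_all add: fst_extend[of f] map_update prod_scale_def)
  then show "Vector_Spaces.linear sB sA (\<lambda>x. f T (xs[i := x]))"
    using assms(1,2)
    by (simp add: Vector_Spaces.linear_iff)
next
  fix T :: ptree and xs :: "'b list" assume "T \<notin> trees n \<or> length xs \<noteq> n"
  then show "f T xs = 0"
    using E by (auto simp: cochains_def fst_extend[of f])
qed

lemma inj_extend: "inj (extend :: ('b::zero, 'a::zero) cochain \<Rightarrow> _)"
proof (rule injI)
  fix f g :: "('b, 'a) cochain"
  assume "extend f = extend g"
  then have "f T xs = g T xs" for T xs by (metis fst_extend)
  then show "f = g" by blast
qed

text \<open>Serves to show that an iterated bracket is an extension, so that
  \<open>derived_bracket\<close> is not the unspecified value.\<close>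

lemma range_extendI:
  assumes "\<And>T zs. snd (G T zs) = 0" "\<And>T zs. G T zs = G T (map (\<lambda>z. (0, snd z)) zs)"
  shows "G \<in> range extend"
proof
  show "G = extend (\<lambda>T xs. fst (G T (map (Pair 0) xs)))"
    using assms by (auto simp: fun_eq_iff extend_def comp_def prod_eq_iff)
qed simp

section \<open>The product twisted by an averaging operator\<close>

text \<open>This turns \<open>df\<close> into a bracket. It supplies the \<open>B\<close> component
  on \<open>T_perp\<close>; that of \<open>[\<pi>, P]\<close> vanishes there, since \<open>P\<close>
  replaces one factor by an element of \<open>A\<close>.\<close>

definition perp_cochain :: "('k \<Rightarrow> 'b::ring \<Rightarrow> 'b) \<Rightarrow> 'k \<Rightarrow> ('a::ring \<times> 'b, 'a \<times> 'b) cochain" where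
  "perp_cochain sB lam T zs = (case zs of [u, v] \<Rightarrow> (0, perp_mult sB lam T (snd u) (snd v)) | _ \<Rightarrow> 0)"

text \<open>
  The quadruple \<open>(S, S', R, R')\<close> stands for the axiom \<open>u S (v S' w) = (u R' v) R w\<close> of a triassociative
  algebra.
\<close>

definition trialgebra_relations :: "(ptree \<times> ptree \<times> ptree \<times> ptree) set" where
  "trialgebra_relations =
     {(T_dashv, T_dashv, T_dashv, T_dashv),
       (T_dashv, T_vdash, T_dashv, T_dashv),
       (T_dashv, T_perp, T_dashv, T_dashv),
       (T_vdash, T_dashv, T_dashv, T_vdash),
       (T_vdash, T_vdash, T_vdash, T_dashv),
       (T_vdash, T_vdash, T_vdash, T_vdash),
       (T_vdash, T_vdash, T_vdash, T_perp),
       (T_perp, T_dashv, T_dashv, T_perp),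
       (T_perp, T_vdash, T_perp, T_dashv),
       (T_vdash, T_perp, T_perp, T_vdash),
       (T_perp, T_perp, T_perp, T_perp)}"

lemma face_trees_3:
  "Q \<in> trees 3 \<Longrightarrow> (face 2 Q, face 0 Q, face 1 Q, face 3 Q) \<in> trialgebra_relations"
  unfolding trees_3
  by (elim insertE emptyE; simp add: trialgebra_relations_def face_def delete_leaves_def Let_def T_dashv_def T_vdash_def T_perp_def)

locale relative_averaging_operator = assoc_bimodule sA sB lact ract
  for sA :: "'k::field \<Rightarrow> 'a::ring \<Rightarrow> 'a" and sB :: "'k \<Rightarrow> 'b::ring \<Rightarrow> 'b" and lact ract +
  fixes lam :: 'k and P :: "'b \<Rightarrow> 'a"
  assumes averaging: "relative_averaging sA sB lact ract lam P"
begin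

abbreviation sE :: "'k \<Rightarrow> 'a \<times> 'b \<Rightarrow> 'a \<times> 'b" where
  "sE \<equiv> prod_scale sA sB"

abbreviation \<pi> :: "('a \<times> 'b, 'a \<times> 'b) cochain" where
  "\<pi> \<equiv> pi_cochain sB lact ract lam"

definition twisted_pi :: "('a \<times> 'b, 'a \<times> 'b) cochain" where
  "twisted_pi T zs = gbracket 2 1 \<pi> (extend (cochain_of_map P)) T zs + perp_cochain sB lam T zs"

lemma P_linear: "Vector_Spaces.linear sB sA P"
  using averaging by (simp add: relative_averaging_def)

lemma P_simps:
  "P (x + y) = P x + P y" "P (sB c x) = sA c (P x)" "P 0 = 0" "P (x - y) = P x - P y"
proof -
  interpret P: Vector_Spaces.linear sB sA P by (rule P_linear)
  show "P (x + y) = P x + P y" "P (sB c x) = sA c (P x)" "P 0 = 0" "P (x - y) = P x - P y"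
    by (rule P.add P.scale P.zero P.diff)+
qed

lemma P_averaging:
  "P (lact (P x) y) = P x * P y" "P (ract x (P y)) = P x * P y" "sA lam (P (x * y)) = P x * P y"
  using averaging unfolding relative_averaging_def by metis+

lemma lact_simps:
  "lact (a + b) x = lact a x + lact b x" "lact (a - b) x = lact a x - lact b x" "lact 0 x = 0"
  "lact (sA c a) x = sB c (lact a x)"
  "lact a (x + y) = lact a x + lact a y" "lact a (x - y) = lact a x - lact a y" "lact a 0 = 0"
  "lact a (sB c x) = sB c (lact a x)"
proof -
  interpret l1: Vector_Spaces.linear sA sB "\<lambda>a. lact a x" for x by (rule lact_linear_alg)
  interpret l2: Vector_Spaces.linear sB sB "\<lambda>x. lact a x" for a by (rule lact_linear_mod)
  show "lact (a + b) x = lact a x + lact b x" "lact (a - b) x = lact a x - lact b x" "lact 0 x = 0"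
    "lact (sA c a) x = sB c (lact a x)"
    "lact a (x + y) = lact a x + lact a y" "lact a (x - y) = lact a x - lact a y" "lact a 0 = 0"
    "lact a (sB c x) = sB c (lact a x)"
    by (rule l1.add l1.scale l1.zero l1.diff l2.add l2.scale l2.zero l2.diff)+
qed

lemma ract_simps:
  "ract x (a + b) = ract x a + ract x b" "ract x (a - b) = ract x a - ract x b" "ract x 0 = 0"
  "ract x (sA c a) = sB c (ract x a)"
  "ract (x + y) a = ract x a + ract y a" "ract (x - y) a = ract x a - ract y a" "ract 0 a = 0"
  "ract (sB c x) a = sB c (ract x a)"
proof -
  interpret r1: Vector_Spaces.linear sA sB "\<lambda>a. ract x a" for x by (rule ract_linear_alg)
  interpret r2: Vector_Spaces.linear sB sB "\<lambda>x. ract x a" for a by (rule ract_linear_mod)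
  show "ract x (a + b) = ract x a + ract x b" "ract x (a - b) = ract x a - ract x b" "ract x 0 = 0"
    "ract x (sA c a) = sB c (ract x a)"
    "ract (x + y) a = ract x a + ract y a" "ract (x - y) a = ract x a - ract y a" "ract 0 a = 0"
    "ract (sB c x) a = sB c (ract x a)"
    by (rule r1.add r1.scale r1.zero r1.diff r2.add r2.scale r2.zero r2.diff)+
qed

text \<open>No term \<open>a * b\<close> occurs, because each term multiplies by a value of
  \<open>P\<close> or applies \<open>P\<close> to a \<open>B\<close> component. So \<open>A\<close>
  is an ideal with zero multiplication, and the quotient \<open>B\<close> carries the products
  \<open>ract x (P y)\<close>, \<open>lact (P x) y\<close> and
  \<open>sB lam (x * y)\<close>.\<close>

lemma twisted_pi_simps:
  "twisted_pi T_dashv [(a, x), (b, y)] = (P x * b + a * P y - P (ract x b), ract x (P y))"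
  "twisted_pi T_vdash [(a, x), (b, y)] = (P x * b + a * P y - P (lact a y), lact (P x) y)"
  "twisted_pi T_perp [(a, x), (b, y)] = (P x * b + a * P y - P (sB lam (x * y)), sB lam (x * y))"
proof -
  have two: "{Suc 0..2} = {Suc 0, 2}" by auto
  have t: "T_dashv \<in> trees 2" "T_vdash \<in> trees 2" "T_perp \<in> trees 2" "T_dashv \<in> trees (Suc (Suc 0))"
    "T_vdash \<in> trees (Suc (Suc 0))" "T_perp \<in> trees (Suc (Suc 0))" "Node [Leaf, Leaf] \<in> trees (Suc 0)"
    by (simp_all add: trees_2 trees_1 flip: numeral_2_eq_2)
  have ne: "T_dashv \<noteq> T_vdash" "T_dashv \<noteq> T_perp" "T_vdash \<noteq> T_perp"
    by (simp_all add: T_dashv_def T_vdash_def T_perp_def)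
  have R: "R_outer 2 (Suc 0) (Suc 0) T = T" "R_outer 2 2 (Suc 0) T = T"
    "R_inner 2 (Suc 0) (Suc 0) T = Node [Leaf, Leaf]" "R_inner 2 2 (Suc 0) T = Node [Leaf, Leaf]"
    "R_outer (Suc 0) (Suc 0) 2 T = Node [Leaf, Leaf]" "R_inner (Suc 0) (Suc 0) 2 T = T"
    if "T \<in> trees 2" for T
    using that unfolding trees_2 R_outer_def R_inner_def delete_leaves_def
    by (auto simp: T_dashv_def T_vdash_def T_perp_def Let_def)
  show "twisted_pi T_dashv [(a, x), (b, y)] = (P x * b + a * P y - P (ract x b), ract x (P y))"
    "twisted_pi T_vdash [(a, x), (b, y)] = (P x * b + a * P y - P (lact a y), lact (P x) y)"
    "twisted_pi T_perp [(a, x), (b, y)] = (P x * b + a * P y - P (sB lam (x * y)), sB lam (x * y))"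
    by (simp_all add: twisted_pi_def gbracket_def partial_comp_def perp_cochain_def perp_mult_def R t two ne ne[symmetric]
      pi_cochain_def extend_def cochain_of_map_def lact_simps ract_simps)
qed

text \<open>Oriented towards products of values of \<open>P\<close>. In the last two rules each of
  the two multiplications absorbs one factor \<open>lam\<close>.\<close>

lemma P_rules:
  "P (lact (P x) y) = P x * P y" "P (ract x (P y)) = P x * P y" "P (sB lam (x * y)) = P x * P y"
  "P (lact a (ract y (P z))) = P (lact a y) * P z"
  "P (x + y) = P x + P y" "P (x - y) = P x - P y" "P 0 = 0"
  "P (sB lam (sB lam (x * (y * z)))) = P x * (P y * P z)"
  "P (sB lam (sB lam (x * y * z))) = P x * (P y * P z)"
proof -
  show *: "P (sB lam (x * y)) = P x * P y" for x y
    using P_averaging(3) P_simps(2) by metis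
  have **: "P (sB lam (sB lam z)) = sA lam (P (sB lam z))" for z by (rule P_simps)
  have "sA lam (P (sB lam (x * (y * z)))) = sA lam (P x * P (y * z))" by (simp only: *)
  also have "\<dots> = P x * P (sB lam (y * z))" by (simp only: P_simps A.scale_mult_right)
  finally show "P (sB lam (sB lam (x * (y * z)))) = P x * (P y * P z)" by (simp only: * **)
  then show "P (sB lam (sB lam (x * y * z))) = P x * (P y * P z)" by (simp only: mult.assoc)
  show "P (lact a (ract y (P z))) = P (lact a y) * P z"
    using P_averaging(2)[of "lact a y" z] by (simp only: lact_ract)
qed (rule P_averaging P_simps)+

text \<open>Both sides are \<open>P\<close> of \<open>lam\<close> times the same element of
  \<open>B\<close>, by \<open>ract_mult_lact\<close>. This is what the axioms require when the
  middle argument comes from \<open>A\<close>.\<close>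

lemma P_mid: "P (ract x b) * P z = P x * P (lact b z)"
  using P_rules(3)[of "ract x b" z] P_rules(3)[of x "lact b z"] by (simp only: ract_mult_lact)

lemma scale_rules:
  "sB c (x + y) = sB c x + sB c y" "sB c (x - y) = sB c x - sB c y"
  "x * sB c y = sB c (x * y)" "sB c x * y = sB c (x * y)"
  by (simp_all add: B.scale_right_distrib B.scale_right_diff_distrib B.scale_mult_left B.scale_mult_right)

lemma twisted_pi_outside: "T \<notin> trees 2 \<Longrightarrow> twisted_pi T zs = 0"
proof -
  assume T: "T \<notin> trees 2"
  then have "T \<noteq> T_perp" by (auto simp: trees_2)
  then have "perp_cochain sB lam T zs = 0"
    by (simp add: perp_cochain_def perp_mult_def zero_prod_def split: list.split)
  then show ?thesis
    using T by (simp add: twisted_pi_def gbracket_outside)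
qed

lemmas group_rules = diff_diff_eq diff_diff_eq2 add_diff_eq diff_add_eq diff_eq_eq eq_diff_eq ac_simps

lemma biadditive_twisted_pi: "biadditive twisted_pi"
proof -
  have "twisted_pi S [u, v + w] = twisted_pi S [u, v] + twisted_pi S [u, w] \<and>
      twisted_pi S [v + w, u] = twisted_pi S [v, u] + twisted_pi S [w, u]" for S u v w
  proof (cases "S \<in> trees 2")
    case True
    then have "S = T_dashv \<or> S = T_vdash \<or> S = T_perp" by (simp add: trees_2)
    moreover obtain a x b y c z where "u = (a, x)" "v = (b, y)" "w = (c, z)"
      by (cases u; cases v; cases w)
    ultimately show ?thesis
      by (elim disjE)
        (simp_all only: twisted_pi_simps add_Pair P_simps lact_simps ract_simps scale_rules ring_distribs
          group_rules simp_thms)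
  qed (simp add: twisted_pi_outside)
  then show ?thesis by (simp add: biadditive_def additive_def)
qed

lemma triassociative_twisted_pi: "triassociative twisted_pi"
proof -
  have "twisted_pi S [u, twisted_pi S' [v, w]] = twisted_pi R [twisted_pi R' [u, v], w]"
    if "(S, S', R, R') \<in> trialgebra_relations" for S S' R R' u v w
  proof -
    obtain a x b y c z where uvw: "u = (a, x)" "v = (b, y)" "w = (c, z)" by (cases u; cases v; cases w)
    show ?thesis
      using that unfolding trialgebra_relations_def uvw
      apply (simp only: insert_iff empty_iff prod.inject)
      apply (elim disjE FalseE conjE; hypsubst; simp only: twisted_pi_simps prod.inject)
      \<comment> \<open>\<open>B.scale_scale\<close> would fuse two scalings by \<open>lam\<close>
        into one by \<open>lam * lam\<close>, which the rules for nested scalings in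
        \<open>P_rules\<close> would not match.\<close>
      apply (simp_all del: B.scale_scale A.scale_scale add: P_rules lact_simps ract_simps ring_distribs mult.assoc
        lact_lact ract_ract[symmetric] lact_ract mult_ract ract_mult_lact lact_mult[symmetric] scale_rules)
      apply (simp_all add: P_mid group_rules)
      done
  qed
  then show ?thesis using face_trees_3 by (simp add: triassociative_def)
qed

end

section \<open>Brackets that are extensions by zero, and the differential as a bracket\<close>

lemma cochains_2I:
  assumes "vector_space s"
    and "\<And>T u v w. T \<in> trees 2 \<Longrightarrow> M T [u + v, w] = M T [u, w] + M T [v, w]"
    and "\<And>T u v w. T \<in> trees 2 \<Longrightarrow> M T [w, u + v] = M T [w, u] + M T [w, v]"
    and "\<And>T c u v. T \<in> trees 2 \<Longrightarrow> M T [s c u, v] = s c (M T [u, v])"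
    and "\<And>T c u v. T \<in> trees 2 \<Longrightarrow> M T [v, s c u] = s c (M T [v, u])"
    and "\<And>T zs. T \<notin> trees 2 \<or> length zs \<noteq> 2 \<Longrightarrow> M T zs = 0"
  shows "M \<in> cochains s s 2"
proof -
  have "Vector_Spaces.linear s s (\<lambda>x. M T (xs[i := x]))"
    if T: "T \<in> trees 2" and xs: "length xs = 2" and i: "i < 2" for T xs i
  proof -
    obtain u v where "xs = [u, v]" using xs by (auto simp: numeral_2_eq_2 length_Suc_conv)
    moreover have "i = 0 \<or> i = 1" using i by auto
    ultimately show ?thesis
      using assms T by (auto simp: Vector_Spaces.linear_iff)
  qed
  then show ?thesis using assms(6) by (simp add: cochains_def)
qed

lemma fst_signed: "fst (signed k v) = signed k (fst v)" and snd_signed: "snd (signed k v) = signed k (snd v)"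
  by (simp_all add: signed_def)

lemma map_merge: "map h (merge i y zs) = merge i (h y) (map h zs)"
  by (simp add: merge_def take_map drop_map)

text \<open>The hypotheses say that \<open>A\<close> is an ideal on which \<open>M\<close> acts
  through \<open>B\<close> components alone. The extreme cofaces then multiply a value of
  \<open>f\<close> in \<open>A\<close>, and the inner ones apply \<open>f\<close> to
  \<open>B\<close> components of \<open>M\<close>. In general \<open>\<pi>\<close> violates them
  because of the products \<open>a * b\<close>, while \<open>[\<pi>, P]\<close> satisfies
  them.\<close>

lemma gbracket_extend_in_range:
  fixes f :: "('b::ab_group_add, 'a::ab_group_add) cochain"
  assumes snd: "\<And>S u v. snd (M S [u, v]) = h S (snd u) (snd v)"
    and h: "\<And>S x. h S 0 x = 0" "\<And>S x. h S x 0 = 0"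
    and left: "\<And>S a v. M S [(a, 0), v] = M S [(a, 0), (0, snd v)]"
    and right: "\<And>S a u. M S [u, (a, 0)] = M S [(0, snd u), (a, 0)]"
    and n: "1 \<le> n"
  shows "gbracket 2 n M (extend f) \<in> range extend"
proof (rule range_extendI)
  let ?z = "\<lambda>z. (0, snd z)"
  fix T and zs :: "('a \<times> 'b) list"
  have *: "snd (gbracket 2 n M (extend f) T zs) = 0 \<and> gbracket 2 n M (extend f) T zs
     = gbracket 2 n M (extend f) T (map ?z zs)"
  proof (cases "T \<in> trees (Suc n) \<and> length zs = Suc n")
    case True
    have "snd (coface M n i (extend f) T zs) = 0" for i zs
      by (simp add: coface_def extend_def snd h)
    moreover have "coface M n i (extend f) T zs = coface M n i (extend f) T (map ?z zs)"
      if i: "i \<le> Suc n" for i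
    proof -
      consider "i = 0" | "i = Suc n" | "1 \<le> i" "i \<le> n" using i by linarith
      then show ?thesis
      proof cases
        case 1
        then show ?thesis
          using True by (simp add: coface_def extend_def right[of _ "zs ! 0"] map_tl comp_def)
      next
        case 2
        then show ?thesis
          using True by (simp add: coface_def extend_def left[of _ _ "zs ! n"] map_butlast comp_def)
      next
        case 3
        then show ?thesis
          using True by (simp add: coface_def extend_def map_merge snd comp_def)
      qed
    qed
    ultimately show ?thesis
      using True n
      by (simp add: gbracket_eq_coface_sum snd_signed snd_sum del: sum.atMost_Suc)
  next
    case False
    then show ?thesis by (simp add: gbracket_outside)
  qed
  then show "snd (gbracket 2 n M (extend f) T zs) = 0"
    "gbracket 2 n M (extend f) T zs = gbracket 2 n M (extend f) T (map ?z zs)" by auto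
qed

context relative_averaging_operator
begin

lemma vector_space_sE: "vector_space sE"
  by (intro vector_space_prod_scale A.vector_space_axioms B.vector_space_axioms)

lemma pi_cochains: "\<pi> \<in> cochains sE sE 2"
proof (rule cochains_2I[OF vector_space_sE])
  show "\<pi> T [u + v, w] = \<pi> T [u, w] + \<pi> T [v, w]" "\<pi> T [w, u + v] = \<pi> T [w, u] + \<pi> T [w, v]"
    "\<pi> T [sE c u, v] = sE c (\<pi> T [u, v])" "\<pi> T [v, sE c u] = sE c (\<pi> T [v, u])" for T u v w c
    by (cases u; cases v; cases w;
        simp add: pi_cochain_def prod_scale_def lact_simps ract_simps scale_rules ring_distribs
          A.scale_mult_left A.scale_mult_right B.scale_left_commute zero_prod_def)+
next
  fix T and zs :: "('a \<times> 'b) list"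
  assume "T \<notin> trees 2 \<or> length zs \<noteq> 2"
  then show "\<pi> T zs = 0"
    by (auto simp: pi_cochain_def trees_2 split: list.splits)
qed

lemma perp_cochains: "perp_cochain sB lam \<in> cochains sE sE 2"
proof (rule cochains_2I[OF vector_space_sE])
  let ?p = "perp_cochain sB lam"
  show "?p T [u + v, w] = ?p T [u, w] + ?p T [v, w]" "?p T [w, u + v] = ?p T [w, u] + ?p T [w, v]"
    "?p T [sE c u, v] = sE c (?p T [u, v])" "?p T [v, sE c u] = sE c (?p T [v, u])"
    for T c and u v w :: "'a \<times> 'b"
    by (cases u; cases v; cases w; cases "T = T_perp";
        simp add: perp_cochain_def perp_mult_def prod_scale_def scale_rules ring_distribs
          mult.commute[of lam c])+
next
  fix T and zs :: "('a \<times> 'b) list"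
  assume "T \<notin> trees 2 \<or> length zs \<noteq> 2"
  then show "perp_cochain sB lam T zs = 0"
    by (auto simp: perp_cochain_def perp_mult_def trees_2 zero_prod_def split: list.splits)
qed

lemma cochain_of_map_cochains: "cochain_of_map P \<in> cochains sB sA 1"
  using P_linear by (auto simp: cochains_def cochain_of_map_def length_Suc_conv)

lemma bracket_pi_P_cochains: "gbracket 2 1 \<pi> (extend (cochain_of_map P)) \<in> cochains sE sE 2"
  using gbracket_cochains[OF vector_space_sE pi_cochains
      extend_cochains[OF A.vector_space_axioms B.vector_space_axioms cochain_of_map_cochains]]
  by simp

lemma extend_cochain_diff:
  fixes f :: "('b, 'a) cochain"
  assumes n: "1 \<le> n"
  shows "extend (cochain_diff sB lam n f) T zs = - gbracket 2 n (perp_cochain sB lam) (extend f) T zs"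
proof (cases "T \<in> trees (Suc n) \<and> length zs = Suc n")
  case True
  let ?c = "\<lambda>i. coface (perp_cochain sB lam) n i (extend f) T zs"
  let ?d = "\<lambda>i. f (face i T)
              (take (i - 1) (map snd zs)
                @ [perp_mult sB lam (R_inner n i 2 T) (map snd zs ! (i - 1)) (map snd zs ! i)]
                @ drop (i + 1) (map snd zs))"
  \<comment> \<open>An extreme coface multiplies a value of \<open>extend f\<close>, whose
    \<open>B\<close> component is 0.\<close>
  have "?c 0 = 0" "?c (Suc n) = 0"
    by (simp_all add: coface_def extend_def perp_cochain_def perp_mult_def zero_prod_def)
  moreover have "{..Suc n} = insert 0 (insert (Suc n) {1..n})" by auto
  ultimately have "(\<Sum>i\<le>Suc n. signed i (?c i)) = (\<Sum>i = 1..n. signed i (?c i))"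
    by (simp del: sum.atMost_Suc)
  also have "\<dots> = (\<Sum>i = 1..n. - signed (i - 1) (?d i, 0))"
  proof (intro sum.cong refl)
    fix i assume i: "i \<in> {1..n}"
    then have "i - 1 < length zs" "i < length zs" using True by auto
    then have "?c i = (?d i, 0)"
      using i True R_inner_2_shape[of T n i]
      by (simp add: coface_def extend_def perp_cochain_def map_merge merge_def take_map drop_map)
    moreover have "i = Suc (i - 1)" using i by simp
    ultimately show "signed i (?c i) = - signed (i - 1) (?d i, 0)" by (metis signed_Suc)
  qed
  finally have sum: "(\<Sum>i\<le>Suc n. signed i (?c i)) = - (\<Sum>i = 1..n. signed (i - 1) (?d i, 0))"
    by (simp add: sum_negf)
  have "signed (n - 1) v = signed (Suc n) v" for v :: 'a
    using n by (intro signed_cong) auto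
  then show ?thesis
    using True n
    by (simp add: gbracket_eq_coface_sum sum cochain_diff_def extend_def prod_eq_iff fst_signed snd_signed
        fst_sum snd_sum signed_minus del: sum.atMost_Suc sum.cl_ivl_Suc)
next
  case False
  then show ?thesis by (auto simp: gbracket_outside cochain_diff_def extend_def zero_prod_def)
qed

text \<open>The inverse of \<open>extend\<close> cancels once the iterated bracket is known to be
  the extension of a genuine cochain; range and multilinearity are shown separately.\<close>

lemma extend_derived_bracket:
  assumes n: "1 \<le> n" and f: "f \<in> cochains sB sA n"
  shows "extend (derived_bracket sA sB lact ract lam 1 n (cochain_of_map P) f) T zs
    = - gbracket 2 n (gbracket 2 1 \<pi> (extend (cochain_of_map P))) (extend f) T zs"
proof -
  define mu where "mu = gbracket 2 1 \<pi> (extend (cochain_of_map P))"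
  let ?G = "\<lambda>T zs. signed 1 (gbracket 2 n mu (extend f) T zs)"
  note vs = A.vector_space_axioms B.vector_space_axioms
  have mu: "mu S zs = twisted_pi S zs - perp_cochain sB lam S zs" for S zs
    by (simp add: twisted_pi_def mu_def)
  have mu_out: "mu S zs = 0" if "S \<notin> trees 2" for S zs
    using that by (simp add: gbracket_outside mu_def)
  \<comment> \<open>The \<open>B\<close> component of \<open>[\<pi>, P]\<close>, which is zero on
    \<open>T_perp\<close>.\<close>
  let ?h = "\<lambda>S x y. if S = T_dashv then ract x (P y) else if S = T_vdash then lact (P x) y else 0"
  have ne: "T_dashv \<noteq> T_vdash" "T_dashv \<noteq> T_perp" "T_vdash \<noteq> T_perp"
    by (simp_all add: T_dashv_def T_vdash_def T_perp_def)
  have "gbracket 2 n mu (extend f) \<in> range extend"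
  proof (rule gbracket_extend_in_range[of _ ?h])
    fix S u v a
    have S: "S \<notin> trees 2 \<and> S \<noteq> T_dashv \<and> S \<noteq> T_vdash \<or> S = T_dashv \<or> S = T_vdash \<or> S = T_perp"
      by (auto simp: trees_2)
    show "snd (mu S [u, v]) = ?h S (snd u) (snd v)"
      using S
      by (cases u; cases v; elim disjE)
        (simp_all add: mu_out, simp_all add: mu twisted_pi_simps perp_cochain_def perp_mult_def ne ne[symmetric])
    show "mu S [(a, 0), v] = mu S [(a, 0), (0, snd v)]"
      using S
      by (cases v; elim disjE)
        (simp_all add: mu_out, simp_all add: mu twisted_pi_simps perp_cochain_def perp_mult_def P_simps lact_simps ract_simps)
    show "mu S [u, (a, 0)] = mu S [(0, snd u), (a, 0)]"
      using S
      by (cases u; elim disjE)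
        (simp_all add: mu_out, simp_all add: mu twisted_pi_simps perp_cochain_def perp_mult_def P_simps lact_simps ract_simps)
  qed (use n in \<open>simp_all add: lact_simps ract_simps P_simps\<close>)
  then obtain h where "gbracket 2 n mu (extend f) = extend h" by blast
  then have G: "?G = extend (\<lambda>T xs. - h T xs)"
    by (simp add: fun_eq_iff extend_def signed_def)
  have "gbracket 2 n mu (extend f) \<in> cochains sE sE (2 + n - 1)"
    using n by (intro gbracket_cochains vector_space_sE bracket_pi_P_cochains[folded mu_def] extend_cochains vs f) auto
  then have "?G \<in> cochains sE sE (1 + n)"
    using cochains_signed[of _ sE sE "2 + n - 1" 1] by simp
  then have "(\<lambda>T xs. - h T xs) \<in> cochains sB sA (1 + n)"
    unfolding G by (rule extend_cochainsD[OF vs])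
  then have "the_inv_into (cochains sB sA (1 + n)) extend (extend (\<lambda>T xs. - h T xs)) = (\<lambda>T xs. - h T xs)"
    by (intro the_inv_into_f_f) (auto intro: inj_on_subset[OF inj_extend])
  then have "extend (derived_bracket sA sB lact ract lam 1 n (cochain_of_map P) f) = ?G"
    by (simp only: derived_bracket_def one_add_one G flip: mu_def)
  then show ?thesis by (simp add: signed_def mu_def)
qed

lemma extend_twisted_diff:
  assumes n: "1 \<le> n" and f: "f \<in> cochains sB sA n"
  shows "extend (twisted_diff sA sB lact ract lam P n f) T zs = - gbracket 2 n twisted_pi (extend f) T zs"
proof -
  note F = extend_cochains[OF A.vector_space_axioms B.vector_space_axioms f]
  have "extend (twisted_diff sA sB lact ract lam P n f) T zs
      = extend (cochain_diff sB lam n f) T zs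
        + extend (derived_bracket sA sB lact ract lam 1 n (cochain_of_map P) f) T zs"
    by (simp add: extend_def twisted_diff_def)
  also have "\<dots> = - gbracket 2 n twisted_pi (extend f) T zs"
    unfolding twisted_pi_def[abs_def]
    by (simp add: extend_cochain_diff[OF n] extend_derived_bracket[OF n f, simplified] gbracket_add_left[OF F])
  finally show ?thesis .
qed

text \<open>Besides being half of the claim, this makes \<open>extend_twisted_diff\<close>
  applicable to the second differential.\<close>

lemma twisted_diff_cochains:
  assumes n: "1 \<le> n" and f: "f \<in> cochains sB sA n"
  shows "twisted_diff sA sB lact ract lam P n f \<in> cochains sB sA (n + 1)"
proof -
  note vs = A.vector_space_axioms B.vector_space_axioms
  have "twisted_pi \<in> cochains sE sE 2"
    unfolding twisted_pi_def[abs_def] by (intro cochains_add bracket_pi_P_cochains perp_cochains)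
  then have "gbracket 2 n twisted_pi (extend f) \<in> cochains sE sE (2 + n - 1)"
    using n by (intro gbracket_cochains vector_space_sE extend_cochains vs f) auto
  then have "(\<lambda>T zs. - gbracket 2 n twisted_pi (extend f) T zs) \<in> cochains sE sE (n + 1)"
    using cochains_minus by fastforce
  then have "extend (twisted_diff sA sB lact ract lam P n f) \<in> cochains sE sE (n + 1)"
    using extend_twisted_diff[OF n f] by presburger
  then show ?thesis by (rule extend_cochainsD[OF vs])
qed

lemma twisted_diff_twisted_diff:
  assumes n: "1 \<le> n" and f: "f \<in> cochains sB sA n"
  shows "twisted_diff sA sB lact ract lam P (n + 1) (twisted_diff sA sB lact ract lam P n f) T xs = 0"
proof -
  let ?g = "twisted_diff sA sB lact ract lam P n f"
  have "gbracket 2 (Suc n) twisted_pi (extend ?g) T zs = 0" for zs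
    using gbracket_gbracket_eq_0[OF triassociative_twisted_pi biadditive_twisted_pi n, of "extend ?g" 1]
      extend_twisted_diff[OF n f] by (simp add: signed_def)
  then have "extend (twisted_diff sA sB lact ract lam P (n + 1) ?g) T zs = 0" for zs
    using extend_twisted_diff[OF _ twisted_diff_cochains[OF n f]] by simp
  then show ?thesis by (subst fst_extend) simp
qed

end

theorem proposition4p14:
  fixes sA :: "'k::field_char_0 \<Rightarrow> 'a::ring \<Rightarrow> 'a"
    and sB :: "'k \<Rightarrow> 'b::ring \<Rightarrow> 'b"
    and lact :: "'a \<Rightarrow> 'b \<Rightarrow> 'b"
    and ract :: "'b \<Rightarrow> 'a \<Rightarrow> 'b"
    and lam :: 'k
    and P :: "'b \<Rightarrow> 'a"
    and n :: nat
    and f :: "('b, 'a) cochain"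
  assumes "lam \<noteq> 0"
    and "assoc_bimodule sA sB lact ract"
    and "relative_averaging sA sB lact ract lam P"
    and "n \<ge> 1"
    and "f \<in> cochains sB sA n"
  shows "twisted_diff sA sB lact ract lam P n f \<in> cochains sB sA (n + 1)
    \<and> twisted_diff sA sB lact ract lam P (n + 1) (twisted_diff sA sB lact ract lam P n f)
      = (\<lambda>T xs. 0)"
proof -
  interpret relative_averaging_operator sA sB lact ract lam P
    by (intro relative_averaging_operator.intro relative_averaging_operator_axioms.intro assms)
  show ?thesis
    using twisted_diff_cochains twisted_diff_twisted_diff assms(4,5) by (simp add: fun_eq_iff)
qed

end
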